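(* There is an absolute constant $c>0$ such that the following holds. Let $p=p(n)$ be a sequence with $6/n \le p(n)<1$ for all $n$ and $p(n)\log n \to 0$ as $n\to\infty$, and let $G\sim D(n,p)$. Then, with probability $1-o(1)$ as $n\to\infty$, $$|\mathrm{MEC}(G)| \ge 2^{\,c\, p^{-1}/\log^2(p^{-1})}.$$ In particular, for all sufficiently large $n$, $\mathbb{E}[|\mathrm{MEC}(G)|] \ge 2^{\,c\, p^{-1}/\log^2(p^{-1})}$.
   Context: For $0<p<1$, $D(n,p)$ is the probability distribution on directed acyclic graphs (DAGs) with vertex set $\{1,\dots,n\}$ (no self-loops) that assigns each DAG with $e$ edges probability proportional to $(p/(1-p))^e$; equivalently, include each of the $n(n-1)$ possible directed edges independently with probability $p$ and condition on acyclicity. Paths and d-separation: a path from $a$ to $b$ in a (mixed) graph is a sequence $v_1,e_1,v_2,e_2,\dots,e_{k-1},v_k$ with $v_1=a\neq b=v_k$ (vertices may repeat), where each $e_j$ is an edge (directed in either direction, or bidirected $\leftrightarrow$) between $v_j$ and $v_{j+1}$. An internal vertex $v_j$ ($1<j<k$) is a collider on the path if both $e_{j-1}$ and $e_j$ have an arrowhead at $v_j$ (i.e. each is either a directed edge pointing into $v_j$ or a bidirected edge). A vertex $x$ is a descendant of $v$ if $x=v$ or there is a directed path $v\to\cdots\to x$. Given $Z\subseteq V\setminus\{a,b\}$, a path is active given $Z$ if every internal non-collider is not in $Z$ and every collider is in $Z$ or has a descendant in $Z$. $a,b$ are d-connected given $Z$ if some path between them is active given $Z$, otherwise d-separated. Two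 graphs on the same vertex set are Markov equivalent if they have exactly the same d-separation statements (for all $a,b,Z$). $\mathrm{MEC}(G)$, the Markov equivalence class of $G$, is the set of all graphs of the same model class (here DAGs) on the same vertex set that are Markov equivalent to $G$. $\log$ is the natural logarithm. *)

theory Defs
  imports "HOL-Analysis.Analysis"
begin

text \<open>DAGs on the vertex set {1..n}, represented by their edge relation.\<close>

definition vset :: "nat \<Rightarrow> nat set" where
  "vset n = {1..n}"

definition dags :: "nat \<Rightarrow> (nat \<times> nat) set set" where
  "dags n = {E. E \<subseteq> {(i,j). i \<in> vset n \<and> j \<in> vset n \<and> i \<noteq> j} \<and> acyclic E}"

text \<open>A path is a vertex list vs (length k \<ge> 2, vertices may repeat) together with
  a list ds of edge orientations: ds!i = True means the edge vs!i \<rightarrow> vs!(i+1),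
  ds!i = False means the edge vs!(i+1) \<rightarrow> vs!i.\<close>

definition is_path :: "(nat \<times> nat) set \<Rightarrow> nat \<Rightarrow> nat \<Rightarrow> nat list \<Rightarrow> bool list \<Rightarrow> bool" where
  "is_path E a b vs ds \<longleftrightarrow> length vs \<ge> 2 \<and> length ds = length vs - 1 \<and>
     hd vs = a \<and> last vs = b \<and> a \<noteq> b \<and>
     (\<forall>i < length ds. (if ds!i then (vs!i, vs!(i+1)) \<in> E else (vs!(i+1), vs!i) \<in> E))"

definition is_collider :: "bool list \<Rightarrow> nat \<Rightarrow> bool" where
  "is_collider ds i \<longleftrightarrow> ds!(i-1) \<and> \<not> ds!i"

definition active_path :: "(nat \<times> nat) set \<Rightarrow> nat set \<Rightarrow> nat list \<Rightarrow> bool list \<Rightarrow> bool" where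
  "active_path E Z vs ds \<longleftrightarrow>
     (\<forall>i. 0 < i \<and> i < length vs - 1 \<longrightarrow>
        (if is_collider ds i then (\<exists>z\<in>Z. (vs!i, z) \<in> E\<^sup>*) else vs!i \<notin> Z))"

definition d_connected :: "(nat \<times> nat) set \<Rightarrow> nat \<Rightarrow> nat \<Rightarrow> nat set \<Rightarrow> bool" where
  "d_connected E a b Z \<longleftrightarrow> (\<exists>vs ds. is_path E a b vs ds \<and> active_path E Z vs ds)"

definition markov_equiv :: "nat \<Rightarrow> (nat \<times> nat) set \<Rightarrow> (nat \<times> nat) set \<Rightarrow> bool" where
  "markov_equiv n G H \<longleftrightarrow>
     (\<forall>a b Z. a \<in> vset n \<and> b \<in> vset n \<and> a \<noteq> b \<and> Z \<subseteq> vset n - {a, b} \<longrightarrow>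
        (d_connected G a b Z \<longleftrightarrow> d_connected H a b Z))"

definition MEC :: "nat \<Rightarrow> (nat \<times> nat) set \<Rightarrow> (nat \<times> nat) set set" where
  "MEC n G = {H \<in> dags n. markov_equiv n G H}"

text \<open>The distribution D(n,p): weight (p/(1-p))^(number of edges), normalised.\<close>

definition dag_weight :: "real \<Rightarrow> (nat \<times> nat) set \<Rightarrow> real" where
  "dag_weight p E = (p / (1 - p)) ^ card E"

definition D_prob :: "nat \<Rightarrow> real \<Rightarrow> (nat \<times> nat) set set \<Rightarrow> real" where
  "D_prob n p S = (\<Sum>G\<in>dags n \<inter> S. dag_weight p G) / (\<Sum>G\<in>dags n. dag_weight p G)"

definition D_expect :: "nat \<Rightarrow> real \<Rightarrow> ((nat \<times> nat) set \<Rightarrow> real) \<Rightarrow> real" where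
  "D_expect n p X = (\<Sum>G\<in>dags n. dag_weight p G * X G) / (\<Sum>G\<in>dags n. dag_weight p G)"

end

theory Submission
  imports Defs "HOL-Real_Asymp.Real_Asymp"
begin

text \<open>
  Call an edge $r \to v$ a root pair if $r$ is a source and $r$ is the only parent of $v$.
  Reversing a root pair yields a Markov equivalent DAG, and root pairs with distinct roots can be
  reversed independently, so a DAG with $R$ roots has an equivalence class of size at least $2^R$.
  The number $X$ of root pairs is concentrated: with $w = p/(1-p)$, deleting a vertex set on top of
  the DAG expresses the moments of $X$ through the mean number $t_n$ of sources of a random DAG on
  $n$ vertices, $E X = w\, t_n t_{n-1}/(1+w)$ and $\mathrm{Var}\, X \le 2\, E X$, where the variance bound
  needs that $t_n$ is nondecreasing. Monotonicity holds because the size-biased source count on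
  $n + 1$ vertices is one plus a binomial thinning of the source count on $n$ vertices, and thinning
  preserves the likelihood ratio order. Moreover $1/(4p) \le t_n \le 1/p$ in the relevant range.
  Finally $R \ge X^2 / \sum_r d_r^2$, where $d_r$ is the number of root pairs at $r$, and
  $\sum_r d_r^2$ is at most $2 \ln^2(1/p)\, E X$ with high probability by Markov's inequality.
\<close>

subsection \<open>d-connection as reachability\<close>

text \<open>Conditioning on acyclicity destroys the independence of the edges. What survives is a
  factorisation: once the edges into a vertex set T are prescribed and all lie inside T, the edges
  leaving T are free and the rest is an arbitrary DAG. The moments needed involve at most four
  vertices, so they become quotients of partition functions, that is, products of mean source
  counts.

  Two root pairs at the same root cannot both be reversed, as their leaves would form a new collider
  at the root. Hence the exponent counts roots instead of pairs, and large values of d_r must be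
  controlled.

  Up to powers of 1 + w, disjoint root pairs contribute a product of four consecutive values of t to
  the second moment, while the squared mean has (t_n t_{n-1})^2; this comparison is where
  monotonicity enters. The bound n p \<ge> 6 puts n beyond the size 1/(2p), where an elementary
  bound for t is already of order 1/p. Markov's inequality with a factor K costs probability 1/K and
  divides the exponent by K; K = ln^2(1/p) is the source of the squared logarithm.\<close>

text \<open>
  The Boolean records whether the last edge of the walk points into its endpoint. Only this
  bit matters for deciding whether the walk can be extended.
\<close>

inductive reach :: "(nat \<times> nat) set \<Rightarrow> nat set \<Rightarrow> nat \<Rightarrow> nat \<Rightarrow> bool \<Rightarrow> bool"
  for E Z a where
  start_out: "(a, y) \<in> E \<Longrightarrow> reach E Z a y True"
| start_in: "(y, a) \<in> E \<Longrightarrow> reach E Z a y False"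
| step_out: "reach E Z a x d \<Longrightarrow> x \<notin> Z \<Longrightarrow> (x, y) \<in> E \<Longrightarrow> reach E Z a y True"
| chain_in: "reach E Z a x False \<Longrightarrow> x \<notin> Z \<Longrightarrow> (y, x) \<in> E \<Longrightarrow> reach E Z a y False"
| collider: "reach E Z a x True \<Longrightarrow> \<exists>z\<in>Z. (x, z) \<in> E\<^sup>* \<Longrightarrow> (y, x) \<in> E \<Longrightarrow> reach E Z a y False"

text \<open>Unlike in \<open>is_path\<close>, the ends may coincide: a walk may return to
  \<open>a\<close> before it reaches its goal, and \<open>reach_active_walk\<close> builds walks one
  edge at a time.\<close>

definition active_walk :: "(nat \<times> nat) set \<Rightarrow> nat set \<Rightarrow> nat \<Rightarrow> nat \<Rightarrow> nat list \<Rightarrow> bool list \<Rightarrow> bool" where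
  "active_walk E Z a b vs ds \<longleftrightarrow> length vs \<ge> 2 \<and> length ds = length vs - 1 \<and> hd vs = a \<and> last vs = b \<and>
     (\<forall>i < length ds. (if ds!i then (vs!i, vs!(i+1)) \<in> E else (vs!(i+1), vs!i) \<in> E)) \<and>
     active_path E Z vs ds"

lemma d_connected_iff_active_walk:
  "d_connected E a b Z \<longleftrightarrow> a \<noteq> b \<and> (\<exists>vs ds. active_walk E Z a b vs ds)"
  unfolding d_connected_def is_path_def active_walk_def by auto

lemma active_walk_nth_reach:
  assumes w: "active_walk E Z a b vs ds" and i: "i < length ds"
  shows "reach E Z a (vs ! Suc i) (ds ! i)"
  using i
proof (induction i)
  case 0
  have "vs ! 0 = a" using w by (cases vs) (auto simp: active_walk_def)
  moreover have "\<forall>i<length ds. if ds!i then (vs!i, vs!(i+1)) \<in> E else (vs!(i+1), vs!i) \<in> E"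
    using w unfolding active_walk_def by (elim conjE)
  from this[rule_format, OF 0]
  have "if ds!0 then (vs!0, vs!Suc 0) \<in> E else (vs!Suc 0, vs!0) \<in> E"
    by (simp only: Suc_eq_plus1)
  ultimately show ?case
    using start_out[of a "vs ! Suc 0" E Z] start_in[of "vs ! Suc 0" a E Z]
    by (cases "ds ! 0") simp_all
next
  case (Suc i)
  have IH: "reach E Z a (vs ! Suc i) (ds ! i)" using Suc by simp
  have e: "if ds!(Suc i) then (vs!(Suc i), vs!(Suc (Suc i))) \<in> E
           else (vs!(Suc (Suc i)), vs!(Suc i)) \<in> E"
    using w Suc.prems by (auto simp: active_walk_def)
  have len: "length ds = length vs - 1" and act: "active_path E Z vs ds"
    using w by (auto simp: active_walk_def)
  have "Suc i < length vs - 1" using Suc.prems len by simp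
  with act have "if is_collider ds (Suc i) then (\<exists>z\<in>Z. (vs!(Suc i), z) \<in> E\<^sup>*) else vs!(Suc i) \<notin> Z"
    unfolding active_path_def by blast
  then show ?case
    using IH e unfolding is_collider_def
    by (cases "ds ! i"; cases "ds ! Suc i")
       (auto intro: step_out chain_in collider)
qed

lemma active_walk_single:
  assumes "if d then (a, y) \<in> E else (y, a) \<in> E"
  shows "active_walk E Z a y [a, y] [d]"
  using assms unfolding active_walk_def active_path_def by auto

lemma active_walk_snoc:
  assumes w: "active_walk E Z a x vs ds"
    and e: "if d then (x, y) \<in> E else (y, x) \<in> E"
    and act: "if last ds \<and> \<not> d then (\<exists>z\<in>Z. (x, z) \<in> E\<^sup>*) else x \<notin> Z"
  shows "active_walk E Z a y (vs @ [y]) (ds @ [d])"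
proof -
  have len: "length vs \<ge> 2" "length ds = length vs - 1"
    and hl: "hd vs = a" "last vs = x"
    and ed: "\<And>i. i < length ds \<Longrightarrow> if ds!i then (vs!i, vs!(i+1)) \<in> E else (vs!(i+1), vs!i) \<in> E"
    and ap: "\<And>i. 0 < i \<Longrightarrow> i < length vs - 1 \<Longrightarrow>
        if is_collider ds i then (\<exists>z\<in>Z. (vs!i, z) \<in> E\<^sup>*) else vs!i \<notin> Z"
    using w unfolding active_walk_def active_path_def by blast+
  have x: "vs ! (length vs - 1) = x" using hl len by (metis last_conv_nth list.size(3) not_numeral_le_zero)
  have ld: "last ds = ds ! (length ds - 1)" using len by (metis One_nat_def Suc_1 diff_is_0_eq last_conv_nth list.size(3) not_less_eq_eq)
  have edges: "if (ds @ [d])!i then ((vs @ [y])!i, (vs @ [y])!(i+1)) \<in> E else ((vs @ [y])!(i+1), (vs @ [y])!i) \<in> E"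
    if "i < length (ds @ [d])" for i
  proof (cases "i < length ds")
    case True
    then show ?thesis using ed[OF True] len by (auto simp: nth_append)
  next
    case False
    then have "i = length vs - 1" using that len by simp
    then show ?thesis using e x len by (auto simp: nth_append)
  qed
  have status: "if is_collider (ds @ [d]) i then (\<exists>z\<in>Z. ((vs @ [y])!i, z) \<in> E\<^sup>*) else (vs @ [y])!i \<notin> Z"
    if "0 < i" "i < length (vs @ [y]) - 1" for i
  proof (cases "i < length vs - 1")
    case True
    then show ?thesis using ap[OF that(1) True] len that
      by (auto simp: nth_append is_collider_def)
  next
    case False
    then have i: "i = length vs - 1" using that len by simp
    then show ?thesis using act x len ld that
      by (auto simp: nth_append is_collider_def)
  qed
  show ?thesis
    unfolding active_walk_def active_path_def
  proof (intro conjI allI impI)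
    show "hd (vs @ [y]) = a" using hl len by (cases vs) auto
    show "length (vs @ [y]) \<ge> 2" "length (ds @ [d]) = length (vs @ [y]) - 1" "last (vs @ [y]) = y"
      using len by auto
  qed (use edges status in blast)+
qed

lemma reach_active_walk:
  assumes "reach E Z a x d"
  shows "\<exists>vs ds. active_walk E Z a x vs ds \<and> last ds = d"
  using assms
proof induction
  case (start_out y)
  then show ?case using active_walk_single[of True a y E Z] by force
next
  case (start_in y)
  then show ?case using active_walk_single[of False a y E Z] by force
next
  case (step_out x d y)
  then show ?case using active_walk_snoc[of E Z a x _ _ True y] by force
next
  case (chain_in x y)
  then show ?case using active_walk_snoc[of E Z a x _ _ False y] by force
next
  case (collider x y)
  then show ?case using active_walk_snoc[of E Z a x _ _ False y] by force
qed

lemma d_connected_iff_reach: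
  "d_connected E a b Z \<longleftrightarrow> a \<noteq> b \<and> (\<exists>d. reach E Z a b d)"
proof -
  have "reach E Z a b (ds ! (length ds - 1))" if "active_walk E Z a b vs ds" for vs ds
  proof -
    have len: "length vs \<ge> 2" "length ds = length vs - 1" "last vs = b"
      using that by (auto simp: active_walk_def)
    then have "vs ! Suc (length ds - 1) = b"
      by (cases vs rule: rev_cases) (auto simp: nth_append)
    then show ?thesis
      using active_walk_nth_reach[OF that, of "length ds - 1"] len by auto
  qed
  then show ?thesis
    unfolding d_connected_iff_active_walk using reach_active_walk by blast
qed

subsection \<open>Reversing root pairs\<close>

text \<open>A special covered edge: in general the ends of a covered edge have the same parents
  apart from the edge itself, and here this common parent set is empty.\<close>

definition root_pair :: "(nat \<times> nat) set \<Rightarrow> nat \<Rightarrow> nat \<Rightarrow> bool" where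
  "root_pair E r v \<longleftrightarrow> (\<forall>x. (x, r) \<notin> E) \<and> (\<forall>x. (x, v) \<in> E \<longleftrightarrow> x = r)"

definition flip :: "nat \<Rightarrow> nat \<Rightarrow> (nat \<times> nat) set \<Rightarrow> (nat \<times> nat) set" where
  "flip r v E = insert (v, r) (E - {(r, v)})"

lemma root_pair_neq: "root_pair E r v \<Longrightarrow> r \<noteq> v"
  unfolding root_pair_def by blast

lemma root_pair_flip: "root_pair E r v \<Longrightarrow> root_pair (flip r v E) v r"
  unfolding root_pair_def flip_def by auto

lemma flip_flip: "root_pair E r v \<Longrightarrow> flip v r (flip r v E) = E"
  unfolding root_pair_def flip_def by auto

text \<open>No edge from outside enters the pair, so a directed path that starts outside never meets
  the edge to be reversed. Hence the collider condition at all other vertices carries over to the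
  reversed graph.\<close>

lemma rtrancl_avoids_root_pair:
  assumes rp: "root_pair E r v" and x: "x \<noteq> r" "x \<noteq> v" and xz: "(x, z) \<in> E\<^sup>*"
  shows "(x, z) \<in> (flip r v E)\<^sup>* \<and> z \<noteq> r \<and> z \<noteq> v"
  using xz
proof (induction rule: rtrancl_induct)
  case base
  then show ?case using x by simp
next
  case (step y z)
  then have "(y, z) \<in> flip r v E" "z \<noteq> r" "z \<noteq> v"
    using rp unfolding root_pair_def flip_def by auto
  then show ?case using step.IH by (meson rtrancl.rtrancl_into_rtrancl)
qed

text \<open>The only edge into \<open>v\<close> comes from \<open>r\<close>, and nothing enters
  \<open>r\<close>; a walk passing through \<open>r\<close> thus arrives there against an arrow,
  which makes \<open>r\<close> a non-collider.\<close>

lemma reach_True_root_pair: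
  assumes "reach E Z a v True" "root_pair E r v"
  shows "(r \<notin> Z \<and> reach E Z a r False) \<or> a = r"
  using assms(1)
proof cases
  case start_out
  then show ?thesis using assms(2) by (auto simp: root_pair_def)
next
  case (step_out x d)
  then have "x = r" using assms(2) by (auto simp: root_pair_def)
  then show ?thesis using step_out assms(2)
    by (cases d) (auto simp: root_pair_def elim: reach.cases)
qed simp_all

text \<open>
  States at the two ends of the pair are matched only loosely: a walk entering or leaving the pair
  through one end may have to take the detour over the other end once the edge is reversed.
\<close>

lemma reach_flip:
  assumes "reach E Z a x d" and rp: "root_pair E r v"
  defines "H \<equiv> flip r v E"
  defines "R \<equiv> \<lambda>x. (\<exists>d. reach H Z a x d) \<or> a = x"
  shows "(x \<noteq> r \<and> x \<noteq> v \<longrightarrow> reach H Z a x d) \<and> (x = r \<longrightarrow> R r) \<and>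
     (x = v \<longrightarrow> (if d then R v \<and> R r else reach H Z a v False))"
proof -
  have E1: "\<And>x. (x, r) \<notin> E" "\<And>x. (x, v) \<in> E \<longleftrightarrow> x = r"
    using rp by (auto simp: root_pair_def)
  have rv: "r \<noteq> v" by (rule root_pair_neq[OF rp])
  have HE: "(x, y) \<in> H" if "(x, y) \<in> E" "y \<noteq> v" for x y
    using that by (auto simp: H_def flip_def)
  have vr: "(v, r) \<in> H" by (auto simp: H_def flip_def)
  have rpH: "root_pair H v r" unfolding H_def by (rule root_pair_flip[OF rp])
  have HvF: "reach H Z a v d \<Longrightarrow> reach H Z a v False" for d
    using rpH by (cases d) (auto simp: root_pair_def elim: reach.cases)
  have out: "reach H Z a y True" if "R x" "x \<notin> Z" "(x, y) \<in> H" for x y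
    using that unfolding R_def by (auto intro: reach.start_out reach.step_out)
  \<comment> \<open>In \<open>H\<close> the roles are exchanged: an arrival at \<open>r\<close>
    along the arrow has come from \<open>v\<close>, and any other presence at \<open>r\<close>
    extends backwards along the new edge, for which \<open>r\<close> must lie outside
    \<open>Z\<close> or be the start.\<close>
  have RvRr: "R r \<Longrightarrow> r \<notin> Z \<or> a = r \<Longrightarrow> R v"
    unfolding R_def using reach_True_root_pair[OF _ rpH] vr
    by (metis (full_types) reach.start_in reach.chain_in)
  have anc: "\<exists>z\<in>Z. (x, z) \<in> H\<^sup>*" if "\<exists>z\<in>Z. (x, z) \<in> E\<^sup>*" "x \<noteq> r" "x \<noteq> v" for x
    using that rtrancl_avoids_root_pair[OF rp] unfolding H_def by blast
  show ?thesis
    using assms(1)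
  proof induction
    case (start_out y)
    then show ?case using E1 HE RvRr unfolding R_def
      by (auto intro: reach.start_out)
  next
    case (start_in y)
    show ?case
    proof (cases "a = v")
      case True
      then have "y = r" using start_in E1 by auto
      then show ?thesis using True vr rv unfolding R_def by (auto intro: reach.start_out)
    next
      case False
      then have "reach H Z a y False" using start_in HE by (auto intro: reach.start_in)
      then show ?thesis unfolding R_def by auto
    qed
  next
    case (step_out x d y)
    have Rx: "R x" using step_out.IH unfolding R_def by (auto split: if_splits)
    show ?case
    proof (cases "y = v")
      case True
      then have "x = r" using step_out E1 by auto
      then show ?thesis using Rx RvRr step_out True rv by auto
    next
      case False
      then show ?thesis using out[OF Rx] step_out E1 HE by auto
    qed
  next
    case (chain_in x y)
    show ?case
    proof (cases "x = v")
      case True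
      then have "y = r" using chain_in E1 by auto
      then show ?thesis using True chain_in vr rv unfolding R_def by (auto intro: reach.step_out)
    next
      case False
      then have "x \<noteq> r" using chain_in E1 by auto
      then have "reach H Z a y False" using False chain_in HE by (auto intro: reach.chain_in)
      then show ?thesis unfolding R_def by auto
    qed
  next
    case (collider x y)
    show ?case
    proof (cases "x = v")
      \<comment> \<open>A walk in \<open>E\<close> can collide at \<open>v\<close> only by going
        from \<open>r\<close> to \<open>v\<close> and back; the induction hypothesis for an arrival
        with \<open>True\<close> at \<open>v\<close> already provides \<open>R r\<close>.\<close>
      case True
      then have "y = r" using collider E1 by auto
      then show ?thesis using True collider rv by auto
    next
      case False
      then have "x \<noteq> r" using collider E1 by auto
      then have "reach H Z a y False"
        using False collider HE[OF \<open>(y, x) \<in> E\<close>] reach.collider[OF _ anc] by blast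
      then show ?thesis unfolding R_def by auto
    qed
  qed
qed

lemma d_connected_flip_imp:
  assumes "root_pair E r v" "d_connected E a b Z"
  shows "d_connected (flip r v E) a b Z"
proof -
  from assms(2) obtain d where "a \<noteq> b" "reach E Z a b d"
    unfolding d_connected_iff_reach by blast
  then show ?thesis
    using reach_flip[OF \<open>reach E Z a b d\<close> assms(1)] unfolding d_connected_iff_reach
    by (cases "b = r"; cases "b = v"; cases d) auto
qed

text \<open>The converse implication is the same one for the reversed graph, where
  \<open>(v, r)\<close> is a root pair and a second flip restores \<open>E\<close>.\<close>

lemma markov_equiv_flip: "root_pair E r v \<Longrightarrow> markov_equiv n E (flip r v E)"
  unfolding markov_equiv_def
  using d_connected_flip_imp[of E r v] d_connected_flip_imp[OF root_pair_flip, of E r v] flip_flip[of E r v]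
  by auto

text \<open>After deletion of the edge from \<open>r\<close> to \<open>v\<close> the vertex
  \<open>v\<close> has no parents, so no directed path from \<open>r\<close> to \<open>v\<close>
  remains that the new edge could close.\<close>

lemma acyclic_flip:
  assumes rp: "root_pair E r v" and "acyclic E"
  shows "acyclic (flip r v E)"
proof -
  have rv: "r \<noteq> v" by (rule root_pair_neq[OF rp])
  have "acyclic (E - {(r, v)})" using assms(2) by (rule acyclic_subset) auto
  moreover have "(r, v) \<notin> (E - {(r, v)})\<^sup>*"
  proof
    assume "(r, v) \<in> (E - {(r, v)})\<^sup>*"
    then show False using rp rv by (cases rule: rtranclE) (auto simp: root_pair_def)
  qed
  ultimately show ?thesis unfolding flip_def by (simp add: acyclic_insert)
qed

text \<open>A closed form for reversing the pairs \<open>(r, f r)\<close> with \<open>r\<close> in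
  \<open>A\<close>; it does not depend on an order of the reversals, which makes \<open>A\<close>
  easy to recover from the result.\<close>

definition flips :: "(nat \<Rightarrow> nat) \<Rightarrow> nat set \<Rightarrow> (nat \<times> nat) set \<Rightarrow> (nat \<times> nat) set" where
  "flips f A E = (E - (\<lambda>r. (r, f r)) ` A) \<union> (\<lambda>r. (f r, r)) ` A"

lemma markov_equiv_trans: "markov_equiv n E F \<Longrightarrow> markov_equiv n F G \<Longrightarrow> markov_equiv n E G"
  unfolding markov_equiv_def by simp

lemma flips_in_MEC:
  assumes E: "E \<in> dags n" and R: "\<And>r. r \<in> R \<Longrightarrow> root_pair E r (f r)"
    and "finite A" "A \<subseteq> R"
  shows "flips f A E \<in> MEC n E \<and> (\<forall>r\<in>R - A. root_pair (flips f A E) r (f r))"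
  using assms(3,4)
proof (induction A)
  case empty
  then show ?case using E R by (auto simp: flips_def MEC_def markov_equiv_def)
next
  case (insert s A)
  let ?F = "flips f A E"
  have s: "root_pair ?F s (f s)" and F: "?F \<in> dags n" "markov_equiv n E ?F"
    using insert by (auto simp: MEC_def)
  \<comment> \<open>A leaf has a single parent and a root has none, so pairs with distinct roots are
    disjoint.\<close>
  have ne: "s \<noteq> r" "f r \<noteq> f s" "f r \<noteq> s" "f s \<noteq> r" if "r \<in> R" "r \<noteq> s" for r
    using R[OF that(1)] R[of s] insert.prems that unfolding root_pair_def by auto
  have eq: "flips f (insert s A) E = flip s (f s) ?F"
  proof -
    have A: "r \<in> R \<and> r \<noteq> s" if "r \<in> A" for r
      using that insert.hyps insert.prems by auto
    have "f s \<notin> A" using ne(4) A by metis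
    moreover have "f r \<noteq> s" if "r \<in> A" for r using ne(3) A[OF that] by metis
    ultimately
    show ?thesis
      using insert.hyps root_pair_neq[OF s] unfolding flips_def flip_def by auto
  qed
  have mem: "s \<in> vset n" "f s \<in> vset n" "s \<noteq> f s"
    using s F root_pair_neq[OF s] unfolding root_pair_def dags_def by auto
  have "flip s (f s) ?F \<in> dags n"
    using acyclic_flip[OF s] F mem unfolding dags_def flip_def by auto
  moreover have "markov_equiv n E (flip s (f s) ?F)"
    using markov_equiv_trans[OF F(2) markov_equiv_flip[OF s]] .
  moreover have "root_pair (flip s (f s) ?F) r (f r)" if "r \<in> R - insert s A" for r
  proof -
    have "root_pair ?F r (f r)" using insert that by auto
    then show ?thesis using ne[of r] that unfolding root_pair_def flip_def by auto
  qed
  ultimately show ?case unfolding eq MEC_def by auto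
qed

lemma finite_dags: "finite (dags n)"
proof (rule finite_subset)
  show "dags n \<subseteq> Pow (vset n \<times> vset n)" unfolding dags_def by auto
  show "finite (Pow (vset n \<times> vset n))" by (simp add: vset_def)
qed

text \<open>Fix one leaf for each root. The set of reversed roots can be read off from the result,
  because the edge from \<open>r\<close> to its leaf survives exactly if \<open>r\<close> was not
  reversed.\<close>

lemma card_MEC_ge:
  assumes E: "E \<in> dags n"
  shows "2 ^ card {r. \<exists>v. root_pair E r v} \<le> card (MEC n E)"
proof -
  define R where "R = {r. \<exists>v. root_pair E r v}"
  define f where "f r = (SOME v. root_pair E r v)" for r
  have f: "root_pair E r (f r)" if "r \<in> R" for r
    using that unfolding f_def R_def by (auto intro: someI_ex)
  have "R \<subseteq> vset n" using E unfolding R_def root_pair_def dags_def by auto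
  then have fin: "finite R" by (rule finite_subset) (simp add: vset_def)
  have mem: "(r, f r) \<in> flips f C E \<longleftrightarrow> r \<notin> C" if "C \<subseteq> R" "r \<in> R" for C r
  proof -
    have "(r, f r) \<in> E" using f[OF that(2)] by (auto simp: root_pair_def)
    moreover have "(r, f r) \<noteq> (f s, s)" if "s \<in> C" for s
      using f[of s] f[OF \<open>r \<in> R\<close>] \<open>C \<subseteq> R\<close> that unfolding root_pair_def by auto
    ultimately show ?thesis unfolding flips_def by auto
  qed
  have inj: "inj_on (\<lambda>A. flips f A E) (Pow R)"
  proof (rule inj_onI)
    fix A B assume A: "A \<in> Pow R" and B: "B \<in> Pow R" and eq: "flips f A E = flips f B E"
    have "r \<in> A \<longleftrightarrow> r \<in> B" if "r \<in> R" for r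
      using mem[of A r] mem[of B r] that A B eq by auto
    then show "A = B" using A B by blast
  qed
  have "flips f A E \<in> MEC n E" if "A \<in> Pow R" for A
    using flips_in_MEC[OF E f, of R A] that finite_subset[OF _ fin, of A] by auto
  then have "(\<lambda>A. flips f A E) ` Pow R \<subseteq> MEC n E" by auto
  then have "card ((\<lambda>A. flips f A E) ` Pow R) \<le> card (MEC n E)"
    by (rule card_mono[rotated]) (auto intro: finite_subset[OF _ finite_dags] simp: MEC_def)
  then show ?thesis by (simp add: card_image[OF inj] card_Pow fin flip: R_def)
qed

subsection \<open>Weights of DAGs with a prescribed top part\<close>

definition dags_on :: "'a set \<Rightarrow> ('a \<times> 'a) set set" where
  "dags_on V = {E. E \<subseteq> V \<times> V \<and> acyclic E}"

definition sources :: "'a set \<Rightarrow> ('a \<times> 'a) set \<Rightarrow> 'a set" where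
  "sources V E = {x \<in> V. \<forall>y. (y, x) \<notin> E}"

definition total_weight :: "real \<Rightarrow> 'a set \<Rightarrow> real" where
  "total_weight w V = (\<Sum>E\<in>dags_on V. w ^ card E)"

lemma dags_eq_dags_on: "dags n = dags_on (vset n)"
  unfolding dags_def dags_on_def acyclic_def by (auto dest: r_into_trancl)

lemma finite_dags_on [simp, intro]: "finite V \<Longrightarrow> finite (dags_on V)"
  by (rule finite_subset[of _ "Pow (V \<times> V)"]) (auto simp: dags_on_def)

lemma finite_dag: "finite V \<Longrightarrow> E \<in> dags_on V \<Longrightarrow> finite E"
  by (rule finite_subset[of _ "V \<times> V"]) (auto simp: dags_on_def)

text \<open>Edges run inside \<open>T\<close>, from \<open>T\<close> to \<open>U\<close> and inside
  \<open>U\<close>, never back. Finiteness turns acyclicity into well-foundedness, which such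
  one-way unions preserve.\<close>

lemma acyclic_top_bottom:
  assumes "finite A" "finite B" "finite P" "acyclic A" "acyclic P"
    and "A \<subseteq> U \<times> U" "B \<subseteq> T \<times> U" "P \<subseteq> T \<times> T" "T \<inter> U = {}"
  shows "acyclic (P \<union> (B \<union> A))"
proof -
  have "B\<^sup>+ = B"
  proof (rule trancl_id, rule transI)
    fix x y z assume "(x, y) \<in> B" "(y, z) \<in> B"
    then show "(x, z) \<in> B" using assms(7,9) by blast
  qed
  then have "acyclic B" unfolding acyclic_def using assms(7,9) by auto
  then have "wf B" "wf A" "wf P" using assms by (auto intro: finite_acyclic_wf)
  moreover have "Domain B \<inter> Range A = {}" "Domain P \<inter> Range (B \<union> A) = {}"
    using assms(6-9) by blast+
  ultimately have "wf (P \<union> (B \<union> A))" by (intro wf_Un)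
  then show ?thesis by (rule wf_acyclic)
qed

text \<open>Since no edge enters \<open>T\<close> from outside, acyclicity constrains
  \<open>P\<close> and the part on \<open>V - T\<close> separately, and any set of edges from
  \<open>T\<close> to \<open>V - T\<close> may be added. This replaces the lost independence of
  edges.\<close>

lemma sum_dags_on_top:
  fixes F :: "('a \<times> 'a) set \<Rightarrow> real"
  assumes V: "finite V" and T: "T \<subseteq> V" and P: "P \<subseteq> T \<times> T" "acyclic P"
  shows "(\<Sum>E\<in>{E \<in> dags_on V. E \<inter> UNIV \<times> T = P}. F E) =
    (\<Sum>E\<in>dags_on (V - T). \<Sum>B\<in>Pow (T \<times> (V - T)). F (P \<union> (B \<union> E)))"
proof -
  let ?U = "V - T"
  let ?h = "\<lambda>(E, B). P \<union> (B \<union> E)"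
  have "bij_betw ?h (dags_on ?U \<times> Pow (T \<times> ?U)) {E \<in> dags_on V. E \<inter> UNIV \<times> T = P}"
  proof (rule bij_betw_byWitness[where f' = "\<lambda>E. (E \<inter> ?U \<times> ?U, E \<inter> T \<times> ?U)"])
    show "\<forall>x\<in>dags_on ?U \<times> Pow (T \<times> ?U). (?h x \<inter> ?U \<times> ?U, ?h x \<inter> T \<times> ?U) = x"
      using P by (auto simp: dags_on_def)
    show "\<forall>E\<in>{E \<in> dags_on V. E \<inter> UNIV \<times> T = P}. ?h (E \<inter> ?U \<times> ?U, E \<inter> T \<times> ?U) = E"
      using T by (auto simp: dags_on_def)
    show "?h ` (dags_on ?U \<times> Pow (T \<times> ?U)) \<subseteq> {E \<in> dags_on V. E \<inter> UNIV \<times> T = P}"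
    proof clarify
      fix E B assume E: "E \<in> dags_on ?U" and B: "B \<subseteq> T \<times> ?U"
      have "acyclic (P \<union> (B \<union> E))"
      proof (rule acyclic_top_bottom[of E B P ?U T])
        show "finite E" using V E finite_dag by blast
        show "finite B" "finite P" using V T P B
          by (meson finite_Diff finite_SigmaI finite_subset)+
      qed (use E B P in \<open>auto simp: dags_on_def\<close>)
      then show "P \<union> (B \<union> E) \<in> dags_on V \<and> (P \<union> (B \<union> E)) \<inter> UNIV \<times> T = P"
        using E B P T unfolding dags_on_def by auto
    qed
    show "(\<lambda>E. (E \<inter> ?U \<times> ?U, E \<inter> T \<times> ?U)) ` {E \<in> dags_on V. E \<inter> UNIV \<times> T = P}
        \<subseteq> dags_on ?U \<times> Pow (T \<times> ?U)"
      by (auto simp: dags_on_def intro: acyclic_subset)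
  qed
  then have "(\<Sum>E\<in>{E \<in> dags_on V. E \<inter> UNIV \<times> T = P}. F E) =
      (\<Sum>x\<in>dags_on ?U \<times> Pow (T \<times> ?U). F (?h x))"
    by (rule sum.reindex_bij_betw[symmetric])
  also have "\<dots> = (\<Sum>E\<in>dags_on ?U. \<Sum>B\<in>Pow (T \<times> ?U). F (P \<union> (B \<union> E)))"
    by (subst sum.cartesian_product) (simp add: case_prod_unfold)
  finally show ?thesis .
qed

lemma sum_power_card_Pow:
  fixes w :: real
  assumes "finite S"
  shows "(\<Sum>B\<in>Pow S. w ^ card B) = (1 + w) ^ card S"
proof -
  have "(\<Prod>x\<in>S. w + 1) = (\<Sum>B\<in>Pow S. (\<Prod>x\<in>B. w) * (\<Prod>x\<in>S-B. 1))"
    by (rule prod_add) (rule assms)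
  then show ?thesis by (simp add: add.commute)
qed

lemma weight_dags_on_top:
  fixes w :: real
  assumes V: "finite V" and T: "T \<subseteq> V" and P: "P \<subseteq> T \<times> T" "acyclic P"
  shows "(\<Sum>E\<in>{E \<in> dags_on V. E \<inter> UNIV \<times> T = P}. w ^ card E) =
    w ^ card P * (1 + w) ^ (card T * (card V - card T)) * total_weight w (V - T)"
proof -
  let ?U = "V - T"
  have fT: "finite T" using T V finite_subset by blast
  have "card (P \<union> (B \<union> E)) = card P + card B + card E"
    if "E \<in> dags_on ?U" "B \<in> Pow (T \<times> ?U)" for E B
  proof -
    have fin: "finite E" "finite B" "finite P"
      using that V P fT finite_dag[of ?U E] by (auto intro: finite_subset[of P "T \<times> T"] finite_subset[of B "T \<times> ?U"])
    have "card (B \<union> E) = card B + card E"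
      using fin that by (intro card_Un_disjoint) (auto simp: dags_on_def)
    moreover have "card (P \<union> (B \<union> E)) = card P + card (B \<union> E)"
      using fin that P by (intro card_Un_disjoint) (auto simp: dags_on_def)
    ultimately show ?thesis by simp
  qed
  then have "(\<Sum>E\<in>{E \<in> dags_on V. E \<inter> UNIV \<times> T = P}. w ^ card E) =
      (\<Sum>E\<in>dags_on ?U. \<Sum>B\<in>Pow (T \<times> ?U). w ^ card P * w ^ card B * w ^ card E)"
    unfolding sum_dags_on_top[OF assms] by (intro sum.cong refl) (simp add: power_add)
  also have "\<dots> = (\<Sum>E\<in>dags_on ?U. w ^ card P * (\<Sum>B\<in>Pow (T \<times> ?U). w ^ card B) * w ^ card E)"
    by (simp add: sum_distrib_left sum_distrib_right)
  also have "\<dots> = w ^ card P * (1 + w) ^ (card T * (card V - card T)) * total_weight w ?U"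
    using V fT T
    by (simp add: sum_power_card_Pow card_cartesian_product card_Diff_subset total_weight_def sum_distrib_left)
  finally show ?thesis .
qed

lemma sources_nonempty:
  assumes "finite V" "V \<noteq> {}" "E \<in> dags_on V"
  shows "sources V E \<noteq> {}"
proof -
  have "wf E" using assms finite_dag by (auto intro: finite_acyclic_wf simp: dags_on_def)
  then obtain z where "z \<in> V" "\<And>y. (y, z) \<in> E \<Longrightarrow> y \<notin> V"
    using assms(2) by (metis ex_in_conv wfE_min)
  then show ?thesis using assms(3) unfolding sources_def dags_on_def by blast
qed

subsection \<open>The number of sources\<close>

definition source_weight :: "real \<Rightarrow> 'a set \<Rightarrow> nat \<Rightarrow> real" where
  "source_weight w V k = (\<Sum>E\<in>{E \<in> dags_on V. card (sources V E) = k}. w ^ card E)"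

text \<open>
  Marking a source multiplies the weight by the number \<open>k\<close> of sources. Deleting the marked
  source leaves a DAG with \<open>l\<close> sources, of which exactly \<open>k - 1\<close> were no children of it.
\<close>

fun source_weight_nat :: "real \<Rightarrow> nat \<Rightarrow> nat \<Rightarrow> real" where
  "source_weight_nat w 0 k = of_bool (k = 0)"
| "source_weight_nat w (Suc n) k = (if k = 0 then 0 else real (Suc n) / real k *
     (\<Sum>l\<le>n. source_weight_nat w n l * (real (l choose (k - 1)) * w ^ (l - (k - 1)) * (1 + w) ^ (n - l))))"

lemma sum_Pow_Un_disjoint:
  fixes F :: "'a set \<Rightarrow> real"
  assumes "A \<inter> B = {}"
  shows "(\<Sum>C\<in>Pow (A \<union> B). F C) = (\<Sum>X\<in>Pow A. \<Sum>Y\<in>Pow B. F (X \<union> Y))"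
proof -
  have "bij_betw (\<lambda>(X, Y). X \<union> Y) (Pow A \<times> Pow B) (Pow (A \<union> B))"
    by (rule bij_betw_byWitness[where f' = "\<lambda>C. (C \<inter> A, C \<inter> B)"]) (use assms in auto)
  from sum.reindex_bij_betw[OF this, of F, symmetric] show ?thesis
    by (simp add: sum.cartesian_product case_prod_unfold)
qed

text \<open>In the application \<open>C\<close> holds the children of a marked source and
  \<open>S\<close> the sources left after its deletion: choose the \<open>j\<close> elements of
  \<open>S\<close> that \<open>C\<close> misses, put the others into \<open>C\<close>, and treat the
  vertices outside \<open>S\<close> as free.\<close>

lemma sum_Pow_card_Diff:
  fixes w :: real
  assumes U: "finite U" and S: "S \<subseteq> U"
  shows "(\<Sum>C\<in>{C \<in> Pow U. card (S - C) = j}. w ^ card C) =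
    real (card S choose j) * w ^ (card S - j) * (1 + w) ^ (card U - card S)"
proof -
  have fS: "finite S" using U S finite_subset by blast
  have U': "U = S \<union> (U - S)" using S by blast
  have "(\<Sum>C\<in>{C \<in> Pow U. card (S - C) = j}. w ^ card C) =
      (\<Sum>C\<in>Pow U. if card (S - C) = j then w ^ card C else 0)"
    by (rule sum.inter_filter) (use U in simp)
  also have "\<dots> = (\<Sum>X\<in>Pow S. \<Sum>Y\<in>Pow (U - S). if card (S - (X \<union> Y)) = j then w ^ card (X \<union> Y) else 0)"
    by (subst U', rule sum_Pow_Un_disjoint) blast
  also have "\<dots> = (\<Sum>X\<in>Pow S. \<Sum>Y\<in>Pow (U - S). (if card (S - X) = j then w ^ card X else 0) * w ^ card Y)"
  proof (intro sum.cong refl)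
    fix X Y assume XY: "X \<in> Pow S" "Y \<in> Pow (U - S)"
    then have "S - (X \<union> Y) = S - X" by blast
    moreover have "card (X \<union> Y) = card X + card Y"
      using XY U fS by (intro card_Un_disjoint) (auto intro: finite_subset)
    ultimately show "(if card (S - (X \<union> Y)) = j then w ^ card (X \<union> Y) else 0) =
        (if card (S - X) = j then w ^ card X else 0) * w ^ card Y"
      by (simp add: power_add)
  qed
  also have "\<dots> = (\<Sum>X\<in>Pow S. if card (S - X) = j then w ^ card X else 0) * (1 + w) ^ card (U - S)"
    using U by (simp add: sum_distrib_left[symmetric] sum_distrib_right[symmetric] sum_power_card_Pow)
  also have "(\<Sum>X\<in>Pow S. if card (S - X) = j then w ^ card X else 0) =
      (\<Sum>Y\<in>Pow S. if card Y = j then w ^ (card S - j) else 0)"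
  proof (rule sum.reindex_bij_witness[where i = "\<lambda>Y. S - Y" and j = "\<lambda>Y. S - Y"])
    fix X assume "X \<in> Pow S"
    then have "card X = card S - card (S - X)"
      using fS by (metis Diff_Diff_Int PowD card_Diff_subset finite_Diff Diff_subset inf.absorb2)
    then show "(if card (S - X) = j then w ^ (card S - j) else 0) =
        (if card (S - X) = j then w ^ card X else 0)" by simp
  qed auto
  also have "\<dots> = (\<Sum>Y\<in>{Y. Y \<subseteq> S \<and> card Y = j}. w ^ (card S - j))"
  proof -
    have "{Y. Y \<subseteq> S \<and> card Y = j} = {Y \<in> Pow S. card Y = j}" by auto
    then show ?thesis using fS by (simp only: sum.inter_filter finite_Pow_iff)
  qed
  also have "\<dots> = real (card S choose j) * w ^ (card S - j)"
    using n_subsets[OF fS] by simp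
  finally show ?thesis using S fS by (simp add: card_Diff_subset)
qed

lemma sources_add_source:
  assumes "r \<in> V" "E \<subseteq> (V - {r}) \<times> (V - {r})" "C \<subseteq> V - {r}"
  shows "sources V (Pair r ` C \<union> E) = insert r (sources (V - {r}) E - C)"
  using assms unfolding sources_def by auto

lemma source_weight_rec:
  fixes V :: "'a set" and w :: real
  assumes V: "finite V"
  shows "real (Suc k) * source_weight w V (Suc k) =
    (\<Sum>r\<in>V. \<Sum>l\<le>card V - 1. source_weight w (V - {r}) l *
        (real (l choose k) * w ^ (l - k) * (1 + w) ^ (card V - 1 - l)))"
proof -
  let ?D = "{E \<in> dags_on V. card (sources V E) = Suc k}"
  have fs: "finite (sources V E)" for E using V by (simp add: sources_def)
  have "real (Suc k) * source_weight w V (Suc k) = (\<Sum>E\<in>?D. \<Sum>r\<in>sources V E. w ^ card E)"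
    unfolding source_weight_def sum_distrib_left by (rule sum.cong) auto
  also have "\<dots> = (\<Sum>E\<in>?D. \<Sum>r\<in>V. if r \<in> sources V E then w ^ card E else 0)"
    using V by (intro sum.cong[OF refl] sum.mono_neutral_cong_left) (auto simp: sources_def)
  also have "\<dots> = (\<Sum>r\<in>V. \<Sum>E\<in>?D. if r \<in> sources V E then w ^ card E else 0)"
    by (rule sum.swap)
  also have "\<dots> = (\<Sum>r\<in>V. \<Sum>l\<le>card V - 1. source_weight w (V - {r}) l *
        (real (l choose k) * w ^ (l - k) * (1 + w) ^ (card V - 1 - l)))"
  proof (rule sum.cong[OF refl])
    fix r assume r: "r \<in> V"
    let ?U = "V - {r}"
    define g where "g l = real (l choose k) * w ^ (l - k) * (1 + w) ^ (card V - 1 - l)" for l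
    have fU: "finite ?U" using V by simp
    have cU: "card ?U = card V - 1" using r V by simp
    let ?F = "\<lambda>E. if card (sources V E) = Suc k then w ^ card E else 0"
    have "(\<Sum>E\<in>?D. if r \<in> sources V E then w ^ card E else 0) =
        (\<Sum>E\<in>dags_on V. if r \<in> sources V E then ?F E else 0)"
      using V by (subst sum.inter_filter) (auto intro!: sum.cong)
    also have "\<dots> = (\<Sum>E\<in>{E \<in> dags_on V. r \<in> sources V E}. ?F E)"
      using V by (simp add: sum.inter_filter)
    also have "{E \<in> dags_on V. r \<in> sources V E} = {E \<in> dags_on V. E \<inter> UNIV \<times> {r} = {}}"
      using r by (auto simp: sources_def)
    also have "(\<Sum>E\<in>\<dots>. ?F E) =
        (\<Sum>E\<in>dags_on ?U. \<Sum>B\<in>Pow ({r} \<times> ?U). ?F ({} \<union> (B \<union> E)))"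
      by (rule sum_dags_on_top) (use V r in \<open>auto simp: acyclic_def\<close>)
    also have "\<dots> = (\<Sum>E\<in>dags_on ?U. w ^ card E * g (card (sources ?U E)))"
    proof (rule sum.cong[OF refl])
      fix E assume E: "E \<in> dags_on ?U"
      have fE: "finite E" using finite_dag[OF fU E] .
      have "bij_betw ((`) (Pair r)) (Pow ?U) (Pow ({r} \<times> ?U))"
      proof (rule bij_betw_Pow)
        show "bij_betw (Pair r) ?U ({r} \<times> ?U)" by (auto simp: bij_betw_def inj_on_def)
      qed
      then have "(\<Sum>B\<in>Pow ({r} \<times> ?U). ?F ({} \<union> (B \<union> E))) =
          (\<Sum>C\<in>Pow ?U. ?F ({} \<union> (Pair r ` C \<union> E)))"
        by (rule sum.reindex_bij_betw[symmetric])
      also have "\<dots> = (\<Sum>C\<in>Pow ?U. if card (sources ?U E - C) = k then w ^ card E * w ^ card C else 0)"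
      proof (rule sum.cong[OF refl])
        fix C assume C: "C \<in> Pow ?U"
        have E': "E \<subseteq> ?U \<times> ?U" using E by (simp add: dags_on_def)
        have "card (Pair r ` C \<union> E) = card (Pair r ` C) + card E"
          using C E' fE finite_subset[OF _ fU] by (intro card_Un_disjoint) auto
        also have "card (Pair r ` C) = card C" by (rule card_image) (simp add: inj_on_def)
        finally have c: "card (Pair r ` C \<union> E) = card C + card E" .
        have "card (sources V (Pair r ` C \<union> E)) = Suc (card (sources ?U E - C))"
        proof -
          have "finite (sources ?U E - C)" using fU by (simp add: sources_def)
          moreover have "r \<notin> sources ?U E" by (simp add: sources_def)
          ultimately show ?thesis using sources_add_source[OF r E', of C] C by simp
        qed
        then show "?F ({} \<union> (Pair r ` C \<union> E)) =
            (if card (sources ?U E - C) = k then w ^ card E * w ^ card C else 0)"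
          by (simp add: c power_add)
      qed
      also have "\<dots> = w ^ card E * (\<Sum>C\<in>{C \<in> Pow ?U. card (sources ?U E - C) = k}. w ^ card C)"
        using fU by (simp add: sum.inter_filter[symmetric] sum_distrib_left)
      also have "\<dots> = w ^ card E * g (card (sources ?U E))"
        by (subst sum_Pow_card_Diff[OF fU]) (auto simp: sources_def g_def cU)
      finally show "(\<Sum>B\<in>Pow ({r} \<times> ?U). ?F ({} \<union> (B \<union> E))) = w ^ card E * g (card (sources ?U E))" .
    qed
    also have "\<dots> = (\<Sum>l\<le>card V - 1. \<Sum>E\<in>{E \<in> dags_on ?U. card (sources ?U E) = l}. w ^ card E * g (card (sources ?U E)))"
    proof (rule sum.group[symmetric])
      show "(\<lambda>E. card (sources ?U E)) ` dags_on ?U \<subseteq> {..card V - 1}"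
      proof -
        have "sources ?U E \<subseteq> ?U" for E by (auto simp: sources_def)
        from card_mono[OF fU this] show ?thesis unfolding cU by auto
      qed
    qed (use fU in auto)
    also have "\<dots> = (\<Sum>l\<le>card V - 1. source_weight w ?U l * g l)"
      unfolding source_weight_def sum_distrib_right by (intro sum.cong) auto
    finally show "(\<Sum>E\<in>?D. if r \<in> sources V E then w ^ card E else 0) =
        (\<Sum>l\<le>card V - 1. source_weight w ?U l * (real (l choose k) * w ^ (l - k) * (1 + w) ^ (card V - 1 - l)))"
      unfolding g_def .
  qed
  finally show ?thesis .
qed

lemma source_weight_eq:
  assumes "finite V"
  shows "source_weight w V k = source_weight_nat w (card V) k"
  using assms
proof (induction "card V" arbitrary: V k)
  case 0
  then have "V = {}" by simp
  moreover have "dags_on ({} :: 'a set) = {{}}" by (auto simp: dags_on_def acyclic_def)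
  ultimately show ?case by (auto simp: source_weight_def sources_def)
next
  case (Suc n)
  have cV: "card V = Suc n" using Suc by simp
  show ?case
  proof (cases k)
    case 0
    have "{E \<in> dags_on V. card (sources V E) = 0} = {}"
    proof -
      have "V \<noteq> {}" using cV by auto
      moreover have "finite (sources V E)" for E using \<open>finite V\<close> by (simp add: sources_def)
      ultimately show ?thesis using sources_nonempty[OF \<open>finite V\<close>] by auto
    qed
    then have "source_weight w V k = 0" using 0 by (simp only: source_weight_def sum.empty)
    then show ?thesis using 0 cV by simp
  next
    case (Suc j)
    have "source_weight w (V - {r}) l = source_weight_nat w n l" if "r \<in> V" for r l
    proof -
      have "card (V - {r}) = n" using that cV \<open>finite V\<close> by simp
      then show ?thesis using Suc.hyps(1)[of "V - {r}" l] \<open>finite V\<close> by simp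
    qed
    then have "real (Suc j) * source_weight w V (Suc j) = real (Suc n) *
       (\<Sum>l\<le>n. source_weight_nat w n l * (real (l choose j) * w ^ (l - j) * (1 + w) ^ (n - l)))"
      unfolding source_weight_rec[OF \<open>finite V\<close>] by (simp add: cV)
    then have "source_weight w V (Suc j) = real (Suc n) / real (Suc j) *
       (\<Sum>l\<le>n. source_weight_nat w n l * (real (l choose j) * w ^ (l - j) * (1 + w) ^ (n - l)))"
      by (simp add: field_simps del: of_nat_Suc)
    then show ?thesis using Suc cV by simp
  qed
qed

section \<open>Likelihood ratio order and total positivity of binomial thinning\<close>

lemma sum_det_nonneg:
  fixes f g u v :: "'i \<Rightarrow> real"
  assumes "\<And>i j. i \<in> I \<Longrightarrow> j \<in> I \<Longrightarrow> (f i * g j - f j * g i) * (u i * v j - u j * v i) \<ge> 0"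
  shows "(\<Sum>i\<in>I. f i * v i) * (\<Sum>i\<in>I. g i * u i) \<le> (\<Sum>i\<in>I. f i * u i) * (\<Sum>i\<in>I. g i * v i)"
proof -
  \<comment> \<open>Cauchy-Binet: this double sum of products of 2x2 minors is twice the difference
    of the two sides.\<close>
  have "0 \<le> (\<Sum>i\<in>I. \<Sum>j\<in>I. (f i * g j - f j * g i) * (u i * v j - u j * v i))"
    by (intro sum_nonneg assms)
  also have "\<dots> = (\<Sum>i\<in>I. \<Sum>j\<in>I. (f i * u i) * (g j * v j)) - (\<Sum>i\<in>I. \<Sum>j\<in>I. (f i * v i) * (g j * u j))
      - (\<Sum>i\<in>I. \<Sum>j\<in>I. (g i * u i) * (f j * v j)) + (\<Sum>i\<in>I. \<Sum>j\<in>I. (g i * v i) * (f j * u j))"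
    unfolding sum_subtractf[symmetric] sum.distrib[symmetric]
    by (intro sum.cong refl) (simp add: algebra_simps)
  also have "\<dots> = 2 * ((\<Sum>i\<in>I. f i * u i) * (\<Sum>i\<in>I. g i * v i) - (\<Sum>i\<in>I. f i * v i) * (\<Sum>i\<in>I. g i * u i))"
    unfolding sum_product[symmetric] by (simp add: algebra_simps)
  finally show ?thesis by simp
qed

text \<open>The likelihood ratio order, stated for unnormalised weights.\<close>

definition lr_le :: "(nat \<Rightarrow> real) \<Rightarrow> (nat \<Rightarrow> real) \<Rightarrow> bool" where
  "lr_le g f \<longleftrightarrow> (\<forall>i j. i < j \<longrightarrow> f i * g j \<le> f j * g i)"

text \<open>If \<open>f\<close> dominates \<open>g\<close> in the order and \<open>u / v\<close> is
  nondecreasing, the two minors have the same sign. With \<open>v = 1\<close> and \<open>u\<close>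
  the identity this compares means; with a thinning kernel at two target values it carries the order
  through thinning.\<close>

lemma lr_le_sum:
  assumes "lr_le g f" and "\<And>l m. l \<in> I \<Longrightarrow> m \<in> I \<Longrightarrow> m < l \<Longrightarrow> u m * v l \<le> u l * v m"
  shows "(\<Sum>i\<in>I. f i * v i) * (\<Sum>i\<in>I. g i * u i) \<le> (\<Sum>i\<in>I. f i * u i) * (\<Sum>i\<in>I. g i * v i)"
proof (rule sum_det_nonneg)
  fix i j assume ij: "i \<in> I" "j \<in> I"
  consider "i < j" | "i = j" | "j < i" by linarith
  then show "(f i * g j - f j * g i) * (u i * v j - u j * v i) \<ge> 0"
  proof cases
    case 1
    then show ?thesis using assms ij unfolding lr_le_def by (intro mult_nonpos_nonpos) auto
  next
    case 3
    then show ?thesis using assms ij unfolding lr_le_def by (intro mult_nonneg_nonneg) auto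
  qed simp
qed

text \<open>The binomial probability that \<open>k\<close> of \<open>l\<close> items survive when
  each does so with probability \<open>1 / (1 + w)\<close>, which is \<open>1 - p\<close> for
  \<open>w = p / (1 - p)\<close>.\<close>

definition thinning :: "real \<Rightarrow> nat \<Rightarrow> nat \<Rightarrow> real" where
  "thinning w l k = real (l choose k) * w ^ (l - k) / (1 + w) ^ l"

text \<open>Total positivity of order two of Pascal's triangle. Multiplication by
  \<open>j choose i\<close> factors out \<open>m choose i\<close> and \<open>l choose i\<close> on
  both sides, which leaves monotonicity of binomial coefficients in the upper argument.\<close>

lemma binomial_minor_nonneg:
  assumes "i < j" "m < l"
  shows "(m choose j) * (l choose i) \<le> (m choose i) * (l choose j)"
proof (cases "j \<le> m")
  case True
  have "(j choose i) * ((m choose j) * (l choose i)) = (m choose i) * ((m - i) choose (j - i)) * (l choose i)"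
    using choose_mult[of i j m] assms True by (simp add: ac_simps)
  also have "\<dots> \<le> (m choose i) * ((l - i) choose (j - i)) * (l choose i)"
    using assms by (intro mult_right_mono mult_left_mono binomial_right_mono) auto
  also have "\<dots> = (j choose i) * ((m choose i) * (l choose j))"
    using choose_mult[of i j l] assms True by (simp add: ac_simps)
  finally show ?thesis using assms by simp
qed (simp add: binomial_eq_0)

lemma thinning_minor_nonneg:
  assumes w: "w > 0" and "i < j" "m < l"
  shows "thinning w m j * thinning w l i \<le> thinning w l j * thinning w m i"
proof (cases "j \<le> m")
  case True
  \<comment> \<open>As \<open>j \<le> m\<close>, all truncated subtractions are exact, and both
    products carry these same powers of \<open>w\<close> and \<open>1 + w\<close>; for
    \<open>m < j\<close> the left side is 0.\<close>
  let ?c = "w ^ (m + l - i - j) / (1 + w) ^ (m + l)"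
  have e: "w ^ (m - a) * w ^ (l - b) = w ^ (m + l - i - j)" if "a + b = i + j" "a \<le> m" "b \<le> l" for a b
    using that by (simp flip: power_add)
  have "thinning w m j * thinning w l i = real ((m choose j) * (l choose i)) * ?c"
    using e[of j i] assms True unfolding thinning_def by (simp add: power_add)
  also have "\<dots> \<le> real ((m choose i) * (l choose j)) * ?c"
    using binomial_minor_nonneg[OF assms(2,3)] w by (intro mult_right_mono) (auto simp del: of_nat_mult)
  also have "\<dots> = real (m choose i) * real (l choose j) * (w ^ (m - i) * w ^ (l - j)) / (1 + w) ^ (m + l)"
    using e[of i j] assms True by simp
  also have "\<dots> = thinning w l j * thinning w m i"
    unfolding thinning_def by (simp add: power_add mult_ac)
  finally show ?thesis .
qed (use w in \<open>simp add: thinning_def binomial_eq_0\<close>)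

lemma source_weight_nat_eq_0: "n < k \<Longrightarrow> source_weight_nat w n k = 0"
  by (cases n) (auto simp: binomial_eq_0 intro!: sum.neutral)

lemma source_weight_nat_nonneg: "w > 0 \<Longrightarrow> source_weight_nat w n k \<ge> 0"
  by (induction n arbitrary: k) (auto intro!: sum_nonneg divide_nonneg_nonneg mult_nonneg_nonneg)

lemma source_weight_nat_Suc_Suc:
  assumes w: "w > 0" and "n \<le> N"
  shows "source_weight_nat w (Suc n) (Suc k) =
    real (Suc n) / real (Suc k) * (1 + w) ^ n * (\<Sum>l\<le>N. source_weight_nat w n l * thinning w l k)"
proof -
  have "(\<Sum>l\<le>n. source_weight_nat w n l * (real (l choose k) * w ^ (l - k) * (1 + w) ^ (n - l))) =
      (\<Sum>l\<le>n. (1 + w) ^ n * (source_weight_nat w n l * thinning w l k))"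
    using w by (intro sum.cong refl) (simp add: thinning_def power_diff)
  also have "\<dots> = (\<Sum>l\<le>N. (1 + w) ^ n * (source_weight_nat w n l * thinning w l k))"
    using assms by (intro sum.mono_neutral_left) (auto simp: source_weight_nat_eq_0)
  finally show ?thesis unfolding sum_distrib_left[symmetric] by simp
qed

text \<open>Two consecutive sizes arise by the same thinning from sizes that are ordered by
  induction. The factors \<open>1 / k\<close> that undo the size bias occur equally in both
  products; the usual stochastic order would not survive them in general.\<close>

lemma lr_le_source_weight_nat:
  assumes w: "w > 0"
  shows "lr_le (source_weight_nat w n) (source_weight_nat w (Suc n))"
proof (induction n)
  case 0
  then show ?case by (simp add: lr_le_def source_weight_nat_nonneg w)
next
  case (Suc n)
  show ?case
    unfolding lr_le_def
  proof (intro allI impI)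
    fix i j :: nat assume ij: "i < j"
    show "source_weight_nat w (Suc (Suc n)) i * source_weight_nat w (Suc n) j \<le> source_weight_nat w (Suc (Suc n)) j * source_weight_nat w (Suc n) i"
    proof (cases i)
      case 0
      then show ?thesis by simp
    next
      case (Suc i')
      then obtain j' where j: "j = Suc j'" using ij by (cases j) auto
      have "(\<Sum>l\<le>Suc n. source_weight_nat w (Suc n) l * thinning w l i') * (\<Sum>l\<le>Suc n. source_weight_nat w n l * thinning w l j')
         \<le> (\<Sum>l\<le>Suc n. source_weight_nat w (Suc n) l * thinning w l j') * (\<Sum>l\<le>Suc n. source_weight_nat w n l * thinning w l i')"
        using ij Suc j
        by (intro lr_le_sum[OF Suc.IH] thinning_minor_nonneg w) auto
      from mult_left_mono[OF this, of "real (Suc (Suc n)) / real (Suc i') * (1 + w) ^ Suc n *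
          (real (Suc n) / real (Suc j') * (1 + w) ^ n)"]
      show ?thesis
        unfolding Suc j source_weight_nat_Suc_Suc[OF w order_refl, of "Suc n"] source_weight_nat_Suc_Suc[OF w le_SucI[OF order_refl], of n]
        using w by (simp add: ac_simps del: of_nat_Suc sum.atMost_Suc power_Suc)
    qed
  qed
qed

section \<open>Partition function and mean number of sources\<close>

definition partition_function :: "real \<Rightarrow> nat \<Rightarrow> real" where
  "partition_function w n = (\<Sum>k\<le>n. source_weight_nat w n k)"

definition mean_sources :: "real \<Rightarrow> nat \<Rightarrow> real" where
  "mean_sources w n = (\<Sum>k\<le>n. real k * source_weight_nat w n k) / partition_function w n"

text \<open>This identifies the recursively computed sum with the normalising constant of D(n,p)
  when \<open>w = p / (1 - p)\<close>, and shows that total weights depend on the number of vertices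
  only.\<close>

lemma total_weight_eq_partition_function:
  assumes "finite V"
  shows "total_weight w V = partition_function w (card V)"
proof -
  have "total_weight w V = (\<Sum>k\<le>card V. source_weight w V k)"
    unfolding total_weight_def source_weight_def
  proof (rule sum.group[symmetric])
    have "sources V E \<subseteq> V" for E by (auto simp: sources_def)
    from card_mono[OF assms this] show "(\<lambda>E. card (sources V E)) ` dags_on V \<subseteq> {..card V}" by auto
  qed (use assms in auto)
  then show ?thesis by (simp add: partition_function_def source_weight_eq assms)
qed

lemma partition_function_pos:
  assumes "w > 0"
  shows "partition_function w n > 0"
proof -
  have "{} \<in> dags_on {..<n}" by (auto simp: dags_on_def acyclic_def)
  then have "total_weight w {..<n} > 0"
    unfolding total_weight_def using assms by (intro sum_pos) auto
  then show ?thesis by (simp add: total_weight_eq_partition_function)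
qed

lemma sum_thinning:
  assumes "w > 0" "l \<le> N"
  shows "(\<Sum>k\<le>N. thinning w l k) = 1"
proof -
  have "(\<Sum>k\<le>N. thinning w l k) = (\<Sum>k\<le>l. thinning w l k)"
    using assms by (intro sum.mono_neutral_right) (auto simp: thinning_def binomial_eq_0)
  also have "\<dots> = (\<Sum>k\<le>l. real (l choose k) * 1 ^ k * w ^ (l - k)) / (1 + w) ^ l"
    by (simp add: thinning_def sum_divide_distrib)
  also have "\<dots> = 1" using assms binomial_ring[of 1 w l] zero_less_power[of "1 + w" l] by simp
  finally show ?thesis .
qed

lemma sum_thinning_mean:
  assumes w: "w > 0" "l \<le> N"
  shows "(\<Sum>k\<le>N. real k * thinning w l k) = real l / (1 + w)"
proof (cases l)
  case 0
  have "real k * thinning w 0 k = 0" for k by (cases k) (auto simp: thinning_def)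
  then have "(\<Sum>k\<le>N. real k * thinning w 0 k) = 0" by (intro sum.neutral) blast
  then show ?thesis using 0 by simp
next
  case (Suc m)
  then obtain M where N: "N = Suc M" "m \<le> M" using assms by (cases N) auto
  have "real (Suc k) * thinning w (Suc m) (Suc k) = real (Suc m) / (1 + w) * thinning w m k" for k
  proof -
    have "real (Suc k) * real (Suc m choose Suc k) = real (Suc m) * real (m choose k)"
      using Suc_times_binomial[of k m] by (metis of_nat_mult)
    then show ?thesis unfolding thinning_def by (simp del: of_nat_Suc binomial_Suc_Suc add: mult.assoc[symmetric])
  qed
  then have "(\<Sum>k\<le>N. real k * thinning w l k) = (\<Sum>k\<le>M. real (Suc m) / (1 + w) * thinning w m k)"
    unfolding N Suc sum.atMost_Suc_shift by simp
  also have "\<dots> = real l / (1 + w)"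
    unfolding sum_distrib_left[symmetric] using sum_thinning[OF w(1) N(2)] Suc by simp
  finally show ?thesis .
qed

text \<open>Multiplication by \<open>k\<close> cancels the \<open>1 / k\<close> of the recursion,
  and \<open>c\<close> is then averaged over one plus a thinned source count. The choices
  \<open>c = 1\<close> and \<open>c = real\<close> give the first two moments.\<close>

lemma sum_sources_source_weight_nat:
  assumes w: "w > 0"
  shows "(\<Sum>k\<le>Suc n. real k * c k * source_weight_nat w (Suc n) k) =
    real (Suc n) * (1 + w) ^ n * (\<Sum>l\<le>n. source_weight_nat w n l * (\<Sum>k\<le>n. c (Suc k) * thinning w l k))"
proof -
  have "(\<Sum>k\<le>Suc n. real k * c k * source_weight_nat w (Suc n) k) =
      (\<Sum>k\<le>n. real (Suc k) * c (Suc k) * source_weight_nat w (Suc n) (Suc k))"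
    by (subst sum.atMost_Suc_shift) (simp del: source_weight_nat.simps)
  also have "\<dots> = (\<Sum>k\<le>n. \<Sum>l\<le>n. real (Suc n) * (1 + w) ^ n * (source_weight_nat w n l * (c (Suc k) * thinning w l k)))"
    unfolding source_weight_nat_Suc_Suc[OF w order_refl] sum_distrib_left
    by (intro sum.cong refl) (simp del: of_nat_Suc)
  also have "\<dots> = (\<Sum>l\<le>n. \<Sum>k\<le>n. real (Suc n) * (1 + w) ^ n * (source_weight_nat w n l * (c (Suc k) * thinning w l k)))"
    by (rule sum.swap)
  finally show ?thesis by (simp only: sum_distrib_left)
qed

text \<open>A marked source can be any of the \<open>Suc n\<close> vertices, and its
  \<open>n\<close> possible outgoing edges are free. The identity turns quotients of consecutive
  partition functions into mean source counts.\<close>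

lemma mean_sources_Suc:
  assumes w: "w > 0"
  shows "mean_sources w (Suc n) * partition_function w (Suc n) = real (Suc n) * (1 + w) ^ n * partition_function w n"
proof -
  have "(\<Sum>k\<le>Suc n. real k * source_weight_nat w (Suc n) k) = real (Suc n) * (1 + w) ^ n * partition_function w n"
    using sum_sources_source_weight_nat[OF w, of "\<lambda>_. 1" n] w
    by (simp add: sum_thinning partition_function_def del: of_nat_Suc sum.atMost_Suc source_weight_nat.simps)
  then show ?thesis using partition_function_pos[OF w, of "Suc n"] by (simp add: mean_sources_def)
qed

lemma second_moment_sources_Suc:
  assumes w: "w > 0"
  shows "(\<Sum>k\<le>Suc n. real k * real k * source_weight_nat w (Suc n) k) =
    (mean_sources w n / (1 + w) + 1) * mean_sources w (Suc n) * partition_function w (Suc n)"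
proof -
  have "(\<Sum>k\<le>Suc n. real k * real k * source_weight_nat w (Suc n) k) =
    real (Suc n) * (1 + w) ^ n * (\<Sum>l\<le>n. source_weight_nat w n l * (\<Sum>k\<le>n. real (Suc k) * thinning w l k))"
    by (rule sum_sources_source_weight_nat[OF w])
  also have "(\<Sum>l\<le>n. source_weight_nat w n l * (\<Sum>k\<le>n. real (Suc k) * thinning w l k)) =
      (\<Sum>l\<le>n. source_weight_nat w n l * (real l / (1 + w) + 1))"
    using w by (intro sum.cong refl) (simp add: distrib_right sum.distrib sum_thinning sum_thinning_mean)
  also have "\<dots> = (\<Sum>l\<le>n. real l * source_weight_nat w n l) / (1 + w) + partition_function w n"
    by (simp add: distrib_left sum.distrib partition_function_def sum_divide_distrib mult.commute)
  also have "(\<Sum>l\<le>n. real l * source_weight_nat w n l) = mean_sources w n * partition_function w n"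
    using partition_function_pos[OF w, of n] by (simp add: mean_sources_def)
  also have "mean_sources w n * partition_function w n / (1 + w) + partition_function w n =
      (mean_sources w n / (1 + w) + 1) * partition_function w n"
    by (simp add: distrib_right)
  finally show ?thesis using mean_sources_Suc[OF w, of n] by (simp add: ac_simps)
qed

lemma mean_sources_mono_Suc:
  assumes w: "w > 0"
  shows "mean_sources w n \<le> mean_sources w (Suc n)"
proof -
  have ext: "(\<Sum>k\<le>Suc n. source_weight_nat w n k * h k) = (\<Sum>k\<le>n. source_weight_nat w n k * h k)" for h
    by (simp add: source_weight_nat_eq_0)
  have "(\<Sum>k\<le>Suc n. source_weight_nat w (Suc n) k * 1) * (\<Sum>k\<le>Suc n. source_weight_nat w n k * real k) \<le>
      (\<Sum>k\<le>Suc n. source_weight_nat w (Suc n) k * real k) * (\<Sum>k\<le>Suc n. source_weight_nat w n k * 1)"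
    by (rule lr_le_sum[OF lr_le_source_weight_nat[OF w]]) simp
  then have "partition_function w (Suc n) * (\<Sum>k\<le>n. real k * source_weight_nat w n k) \<le>
      (\<Sum>k\<le>Suc n. real k * source_weight_nat w (Suc n) k) * partition_function w n"
    using ext[of "\<lambda>_. 1"] unfolding ext partition_function_def mult_1_right by (simp only: mult.commute)
  then show ?thesis
    using partition_function_pos[OF w, of n] partition_function_pos[OF w, of "Suc n"]
    unfolding mean_sources_def by (simp add: divide_simps mult.commute del: sum.atMost_Suc source_weight_nat.simps)
qed

lemma mean_sources_mono: "w > 0 \<Longrightarrow> m \<le> n \<Longrightarrow> mean_sources w m \<le> mean_sources w n"
  using lift_Suc_mono_le[of "mean_sources w"] mean_sources_mono_Suc by blast

lemma mean_sources_Suc_pos: "w > 0 \<Longrightarrow> mean_sources w (Suc n) > 0"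
  using mean_sources_Suc[of w n] partition_function_pos[of w n] partition_function_pos[of w "Suc n"]
  by (smt (verit) mult_pos_pos of_nat_0_less_iff zero_less_Suc zero_less_mult_pos2 zero_less_power)

text \<open>Size biasing cannot lower the mean, so t_{n+1} \<le> 1 + t_n / (1 + w); with t_n \<le>
  t_{n+1} this solves to t_n \<le> (1 + w) / w, which is 1/p.\<close>

lemma mean_sources_le:
  assumes w: "w > 0"
  shows "w * mean_sources w n \<le> 1 + w"
proof -
  let ?f = "source_weight_nat w (Suc n)" and ?t = "mean_sources w (Suc n)" and ?z = "partition_function w (Suc n)"
  have z: "?z > 0" by (rule partition_function_pos[OF w])
  have t: "?t > 0" by (rule mean_sources_Suc_pos[OF w])
  have "(\<Sum>k\<le>Suc n. (real k * ?f k) * 1) * (\<Sum>k\<le>Suc n. ?f k * real k) \<le>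
      (\<Sum>k\<le>Suc n. (real k * ?f k) * real k) * (\<Sum>k\<le>Suc n. ?f k * 1)"
  proof (rule sum_det_nonneg)
    fix i j
    have "(real i * ?f i * ?f j - real j * ?f j * ?f i) * (real i * 1 - real j * 1) =
        ?f i * ?f j * (real i - real j)\<^sup>2"
      by (simp add: power2_eq_square algebra_simps del: source_weight_nat.simps)
    then show "(real i * ?f i * ?f j - real j * ?f j * ?f i) * (real i * 1 - real j * 1) \<ge> 0"
      by (simp add: source_weight_nat_nonneg[OF w] del: source_weight_nat.simps)
  qed
  moreover have "(\<Sum>k\<le>Suc n. real k * ?f k) = ?t * ?z"
    using z by (simp add: mean_sources_def del: sum.atMost_Suc source_weight_nat.simps)
  moreover have "(\<Sum>k\<le>Suc n. (real k * ?f k) * real k) = (mean_sources w n / (1 + w) + 1) * ?t * ?z"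
    using second_moment_sources_Suc[OF w, of n] by (simp only: ac_simps)
  ultimately have "(?t * ?z) * (?t * ?z) \<le> (mean_sources w n / (1 + w) + 1) * ?t * ?z * ?z"
    unfolding partition_function_def mult_1_right by (simp only: mult.commute[of "?f _"])
  then have "(?t * ?z * ?z) * ?t \<le> (?t * ?z * ?z) * (mean_sources w n / (1 + w) + 1)"
    by (simp only: ac_simps)
  then have "?t \<le> mean_sources w n / (1 + w) + 1"
    using t z by (subst (asm) mult_le_cancel_left_pos) auto
  then have "mean_sources w n \<le> mean_sources w n / (1 + w) + 1"
    using mean_sources_mono_Suc[OF w, of n] by linarith
  then show ?thesis using w by (simp add: field_simps)
qed

text \<open>Remove all edges into one fixed vertex, which then is a source.\<close>

lemma partition_function_Suc_le:
  assumes w: "w > 0"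
  shows "partition_function w (Suc n) \<le> (1 + w) ^ n * ((1 + w) ^ n * partition_function w n)"
proof -
  let ?V = "{..n}" and ?r = n
  let ?D = "{E \<in> dags_on ?V. E \<inter> UNIV \<times> {?r} = {}}"
  let ?h = "\<lambda>E. (E - UNIV \<times> {?r}, {y. (y, ?r) \<in> E})"
  have inj: "inj_on ?h (dags_on ?V)"
  proof (rule inj_onI)
    fix E F assume "?h E = ?h F"
    then have "E - UNIV \<times> {?r} = F - UNIV \<times> {?r}" "\<And>y. (y, ?r) \<in> E \<longleftrightarrow> (y, ?r) \<in> F" by auto
    then show "E = F" by auto
  qed
  have sub: "?h ` dags_on ?V \<subseteq> ?D \<times> Pow {..<n}"
  proof clarify
    fix E assume E: "E \<in> dags_on ?V"
    then have "E - UNIV \<times> {?r} \<in> ?D" by (auto simp: dags_on_def intro: acyclic_subset)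
    moreover have "(?r, ?r) \<notin> E" using E by (auto simp: dags_on_def acyclic_def)
    then have "{y. (y, ?r) \<in> E} \<subseteq> {..<n}"
      using E by (force simp: dags_on_def less_le)
    ultimately show "E - UNIV \<times> {?r} \<in> ?D \<and> {y. (y, ?r) \<in> E} \<in> Pow {..<n}" by simp
  qed
  have c: "card E = card (E - UNIV \<times> {?r}) + card {y. (y, ?r) \<in> E}" if "E \<in> dags_on ?V" for E
  proof -
    have "finite E" using that finite_dag by blast
    then have "card E = card (E - UNIV \<times> {?r}) + card (E \<inter> UNIV \<times> {?r})"
      using card_Diff_subset_Int[of E "UNIV \<times> {?r}"] card_mono[of E "E \<inter> UNIV \<times> {?r}"] by auto
    also have "E \<inter> UNIV \<times> {?r} = (\<lambda>y. (y, ?r)) ` {y. (y, ?r) \<in> E}" by auto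
    finally show ?thesis by (simp add: card_image inj_on_def)
  qed
  have "partition_function w (Suc n) = (\<Sum>E\<in>dags_on ?V. w ^ card E)"
    using total_weight_eq_partition_function[of ?V w] by (simp add: total_weight_def)
  also have "\<dots> = (\<Sum>E\<in>dags_on ?V. (\<lambda>(F, B). w ^ card F * w ^ card B) (?h E))"
    by (rule sum.cong[OF refl]) (simp add: c power_add)
  also have "\<dots> = (\<Sum>(F, B)\<in>?h ` dags_on ?V. w ^ card F * w ^ card B)"
    by (simp only: sum.reindex[OF inj] comp_def)
  \<comment> \<open>Equality fails in general, since giving a parent set back to \<open>?r\<close>
    may create a cycle.\<close>
  also have "\<dots> \<le> (\<Sum>(F, B)\<in>?D \<times> Pow {..<n}. w ^ card F * w ^ card B)"
    using w by (intro sum_mono2 sub) auto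
  also have "\<dots> = (\<Sum>F\<in>?D. w ^ card F) * (\<Sum>B\<in>Pow {..<n}. w ^ card B)"
    by (simp add: sum.cartesian_product[symmetric] sum_product)
  also have "(\<Sum>B\<in>Pow {..<n}. w ^ card B) = (1 + w) ^ n"
    by (simp add: sum_power_card_Pow)
  also have "(\<Sum>F\<in>?D. w ^ card F) = (1 + w) ^ n * partition_function w n"
  proof -
    have "(\<Sum>F\<in>?D. w ^ card F) = w ^ card ({} :: (nat \<times> nat) set) *
        (1 + w) ^ (card {?r} * (card ?V - card {?r})) * total_weight w (?V - {?r})"
      by (rule weight_dags_on_top) (auto simp: acyclic_def)
    then show ?thesis by (simp add: total_weight_eq_partition_function)
  qed
  finally show ?thesis by (simp only: ac_simps)
qed

text \<open>For \<open>w = p / (1 - p)\<close> the bound is (n+1)(1-p)^n, the mean number of sources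
  of the unconditioned random digraph on n+1 vertices; conditioning on acyclicity does not lower
  it.\<close>

lemma mean_sources_ge:
  assumes w: "w > 0"
  shows "mean_sources w (Suc n) \<ge> real (Suc n) / (1 + w) ^ n"
proof -
  have z: "partition_function w (Suc n) > 0" by (rule partition_function_pos[OF w])
  have "real (Suc n) / (1 + w) ^ n * partition_function w (Suc n) \<le>
      real (Suc n) / (1 + w) ^ n * ((1 + w) ^ n * ((1 + w) ^ n * partition_function w n))"
    using partition_function_Suc_le[OF w, of n] w by (intro mult_left_mono) auto
  also have "\<dots> = mean_sources w (Suc n) * partition_function w (Suc n)"
    using w unfolding mean_sources_Suc[OF w] by simp
  finally show ?thesis using z by (simp only: mult_le_cancel_right_pos)
qed

subsection \<open>Moments of the number of root pairs\<close>

lemma acyclic_bipartite: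
  assumes "Domain P \<inter> Range P = {}"
  shows "acyclic P"
proof -
  have "P\<^sup>+ = P" by (rule trancl_id, rule transI) (use assms in blast)
  then show ?thesis using assms unfolding acyclic_def by auto
qed

lemma sum_constant_off:
  fixes c :: real
  assumes "finite V" "S \<subseteq> V" "\<And>v. v \<in> S \<Longrightarrow> g v = 0" "\<And>v. v \<in> V - S \<Longrightarrow> g v = c"
  shows "sum g V = (real (card V) - real (card S)) * c"
proof -
  have "sum g V = (\<Sum>v\<in>V - S. c)"
    using assms by (intro sum.mono_neutral_cong_right) auto
  then show ?thesis
    using assms(1,2) by (simp add: card_Diff_subset finite_subset card_mono of_nat_diff)
qed

definition dag_sum :: "nat \<Rightarrow> real \<Rightarrow> ((nat \<times> nat) set \<Rightarrow> real) \<Rightarrow> real" where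
  "dag_sum n w F = (\<Sum>E\<in>dags n. w ^ card E * F E)"

lemma dag_sum_sum: "dag_sum n w (\<lambda>E. \<Sum>i\<in>I. F i E) = (\<Sum>i\<in>I. dag_sum n w (F i))"
  unfolding dag_sum_def by (subst sum.swap) (simp add: sum_distrib_left)

lemma dag_sum_eq_0: "(\<And>E. E \<in> dags n \<Longrightarrow> F E = 0) \<Longrightarrow> dag_sum n w F = 0"
  unfolding dag_sum_def by simp

lemma dag_sum_one: "dag_sum n w (\<lambda>_. 1) = partition_function w n"
  using total_weight_eq_partition_function[of "vset n" w]
  by (simp add: dag_sum_def total_weight_def dags_eq_dags_on vset_def)

lemma dag_sum_top:
  assumes T: "T \<subseteq> vset n" and P: "P \<subseteq> T \<times> T" "Domain P \<inter> Range P = {}"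
    and F: "\<And>E. F E = of_bool (E \<inter> UNIV \<times> T = P)"
    and c: "card T = k" "card P = j"
  shows "dag_sum n w F = w ^ j * (1 + w) ^ (k * (n - k)) * partition_function w (n - k)"
proof -
  have V: "finite (vset n)" "card (vset n) = n" by (auto simp: vset_def)
  have "dag_sum n w F = (\<Sum>E\<in>dags_on (vset n). if E \<inter> UNIV \<times> T = P then w ^ card E else 0)"
    unfolding dag_sum_def dags_eq_dags_on F by (intro sum.cong) auto
  also have "\<dots> = (\<Sum>E\<in>{E \<in> dags_on (vset n). E \<inter> UNIV \<times> T = P}. w ^ card E)"
    using V by (simp only: sum.inter_filter finite_dags_on)
  also have "\<dots> = w ^ card P * (1 + w) ^ (card T * (card (vset n) - card T)) * total_weight w (vset n - T)"
    by (rule weight_dags_on_top[OF V(1) T P(1) acyclic_bipartite[OF P(2)]])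
  finally show ?thesis
    using V T finite_subset[OF T V(1)] c by (simp add: total_weight_eq_partition_function card_Diff_subset)
qed

definition root_pair_ind :: "nat \<Rightarrow> nat \<Rightarrow> (nat \<times> nat) set \<Rightarrow> real" where
  "root_pair_ind r v E = of_bool (root_pair E r v)"

text \<open>
  The total weight of the DAGs in which a given set of \<open>k\<close> vertices receives exactly \<open>j\<close>
  prescribed edges, all of them inside that set.
\<close>

definition top_weight :: "real \<Rightarrow> nat \<Rightarrow> nat \<Rightarrow> nat \<Rightarrow> real" where
  "top_weight w n j k = w ^ j * (1 + w) ^ (k * (n - k)) * partition_function w (n - k)"

lemma Int_UNIV_times_eq_iff:
  assumes "P \<subseteq> UNIV \<times> T"
  shows "E \<inter> UNIV \<times> T = P \<longleftrightarrow> (\<forall>y\<in>T. \<forall>x. (x, y) \<in> E \<longleftrightarrow> (x, y) \<in> P)"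
  using assms by auto

lemma dag_sum_root_pair_ind:
  assumes "r \<in> vset n" "v \<in> vset n" "r \<noteq> v"
  shows "dag_sum n w (root_pair_ind r v) = top_weight w n 1 2"
  unfolding top_weight_def
  by (rule dag_sum_top[where T = "{r, v}" and P = "{(r, v)}"])
     (use assms in \<open>auto simp: root_pair_ind_def root_pair_def Int_UNIV_times_eq_iff\<close>)

lemma dag_sum_root_pair_ind_same_root:
  assumes "r \<in> vset n" "v \<in> vset n" "v' \<in> vset n" "r \<noteq> v" "r \<noteq> v'" "v \<noteq> v'"
  shows "dag_sum n w (\<lambda>E. root_pair_ind r v E * root_pair_ind r v' E) = top_weight w n 2 3"
  unfolding top_weight_def
  by (rule dag_sum_top[where T = "{r, v, v'}" and P = "{(r, v), (r, v')}"])
     (use assms in \<open>auto simp: root_pair_ind_def root_pair_def Int_UNIV_times_eq_iff\<close>)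

lemma dag_sum_root_pair_ind_disjoint:
  assumes "r \<in> vset n" "v \<in> vset n" "r' \<in> vset n" "v' \<in> vset n" "distinct [r, v, r', v']"
  shows "dag_sum n w (\<lambda>E. root_pair_ind r v E * root_pair_ind r' v' E) = top_weight w n 2 4"
  unfolding top_weight_def
  by (rule dag_sum_top[where T = "{r, v, r', v'}" and P = "{(r, v), (r', v')}"])
     (use assms in \<open>auto simp: root_pair_ind_def root_pair_def Int_UNIV_times_eq_iff\<close>)

definition leaf_count :: "nat \<Rightarrow> nat \<Rightarrow> (nat \<times> nat) set \<Rightarrow> real" where
  "leaf_count n r E = (\<Sum>v\<in>vset n. root_pair_ind r v E)"

definition pair_count :: "nat \<Rightarrow> (nat \<times> nat) set \<Rightarrow> real" where
  "pair_count n E = (\<Sum>r\<in>vset n. leaf_count n r E)"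

definition square_count :: "nat \<Rightarrow> (nat \<times> nat) set \<Rightarrow> real" where
  "square_count n E = (\<Sum>r\<in>vset n. (leaf_count n r E)\<^sup>2)"

lemma dag_sum_pair_count:
  "dag_sum n w (pair_count n) = real n * (real n - 1) * top_weight w n 1 2"
proof -
  have V: "finite (vset n)" "card (vset n) = n" by (auto simp: vset_def)
  have "(\<Sum>v\<in>vset n. dag_sum n w (root_pair_ind r v)) = (real n - 1) * top_weight w n 1 2" if "r \<in> vset n" for r
  proof -
    have "root_pair_ind r r E = 0" for E using root_pair_neq[of E r r] by (auto simp: root_pair_ind_def)
    then show ?thesis
      using sum_constant_off[OF V(1), of "{r}" "\<lambda>v. dag_sum n w (root_pair_ind r v)"] that V dag_sum_root_pair_ind[of r n]
      by (auto simp: dag_sum_def)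
  qed
  then show ?thesis
    unfolding pair_count_def leaf_count_def dag_sum_sum using V by simp
qed

lemma dag_sum_leaf_count_mult:
  "dag_sum n w (\<lambda>E. leaf_count n r E * leaf_count n r' E) =
    (\<Sum>v\<in>vset n. \<Sum>v'\<in>vset n. dag_sum n w (\<lambda>E. root_pair_ind r v E * root_pair_ind r' v' E))"
  unfolding leaf_count_def sum_product dag_sum_sum ..

lemma dag_sum_leaf_count_square:
  assumes r: "r \<in> vset n"
  shows "dag_sum n w (\<lambda>E. leaf_count n r E * leaf_count n r E) =
    (real n - 1) * (top_weight w n 1 2 + (real n - 2) * top_weight w n 2 3)"
proof -
  have V: "finite (vset n)" "card (vset n) = n" by (auto simp: vset_def)
  have rr: "root_pair_ind r r E = 0" for E using root_pair_neq[of E r r] by (auto simp: root_pair_ind_def)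
  have "(\<Sum>v'\<in>vset n. dag_sum n w (\<lambda>E. root_pair_ind r v E * root_pair_ind r v' E)) =
      top_weight w n 1 2 + (real n - 2) * top_weight w n 2 3" if v: "v \<in> vset n - {r}" for v
  proof -
    let ?g = "\<lambda>v'. dag_sum n w (\<lambda>E. root_pair_ind r v E * root_pair_ind r v' E)"
    have idem: "(\<lambda>E. root_pair_ind r v E * root_pair_ind r v E) = root_pair_ind r v" by (auto simp: root_pair_ind_def)
    have "sum ?g (vset n) = ?g v + sum ?g (vset n - {v})"
      using V v by (intro sum.remove) auto
    also have "?g v = top_weight w n 1 2" unfolding idem using dag_sum_root_pair_ind[of r n v] r v by auto
    also have "sum ?g (vset n - {v}) = (real (card (vset n - {v})) - real (card {r})) * top_weight w n 2 3"
    proof (rule sum_constant_off)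
      show "?g v' = top_weight w n 2 3" if "v' \<in> vset n - {v} - {r}" for v'
        using dag_sum_root_pair_ind_same_root[of r n v v'] r v that by auto
    qed (use V r v rr in \<open>auto simp: dag_sum_def\<close>)
    also have "real (card (vset n - {v})) - real (card {r}) = real n - 2"
    proof -
      have "card (vset n - {v}) = n - 1" "n > 0" using V v by (auto simp: vset_def)
      then show ?thesis by (simp add: of_nat_diff)
    qed
    finally show ?thesis .
  qed
  then have "(\<Sum>v\<in>vset n. \<Sum>v'\<in>vset n. dag_sum n w (\<lambda>E. root_pair_ind r v E * root_pair_ind r v' E)) =
      (real (card (vset n)) - real (card {r})) * (top_weight w n 1 2 + (real n - 2) * top_weight w n 2 3)"
    using V r rr by (intro sum_constant_off) (auto simp: dag_sum_def)
  then show ?thesis unfolding dag_sum_leaf_count_mult using V by simp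
qed

lemma dag_sum_leaf_count_distinct:
  assumes r: "r \<in> vset n" "r' \<in> vset n" "r \<noteq> r'"
  shows "dag_sum n w (\<lambda>E. leaf_count n r E * leaf_count n r' E) = (real n - 2) * ((real n - 3) * top_weight w n 2 4)"
proof -
  have V: "finite (vset n)" "card (vset n) = n" by (auto simp: vset_def)
  \<comment> \<open>Root pairs with distinct roots and a common vertex are incompatible, so only
    disjoint pairs contribute.\<close>
  have z: "root_pair_ind r v E * root_pair_ind r' v' E = 0" if "v \<in> {r, r'} \<or> v' \<in> {r, r', v}" for v v' E
    using that r(3) by (auto simp: root_pair_ind_def root_pair_def)
  have "(\<Sum>v'\<in>vset n. dag_sum n w (\<lambda>E. root_pair_ind r v E * root_pair_ind r' v' E)) =
      (real (card (vset n)) - real (card {r, r', v})) * top_weight w n 2 4" if v: "v \<in> vset n - {r, r'}" for v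
  proof (rule sum_constant_off)
    show "dag_sum n w (\<lambda>E. root_pair_ind r v E * root_pair_ind r' v' E) = top_weight w n 2 4"
      if "v' \<in> vset n - {r, r', v}" for v'
      by (rule dag_sum_root_pair_ind_disjoint) (use r v that in auto)
    show "dag_sum n w (\<lambda>E. root_pair_ind r v E * root_pair_ind r' v' E) = 0" if "v' \<in> {r, r', v}" for v'
      by (rule dag_sum_eq_0) (use that z in blast)
  qed (use V r v in auto)
  then have "(\<Sum>v'\<in>vset n. dag_sum n w (\<lambda>E. root_pair_ind r v E * root_pair_ind r' v' E)) =
      (real n - 3) * top_weight w n 2 4" if "v \<in> vset n - {r, r'}" for v
    using that r V by (simp add: card_insert_if)
  then have "(\<Sum>v\<in>vset n. \<Sum>v'\<in>vset n. dag_sum n w (\<lambda>E. root_pair_ind r v E * root_pair_ind r' v' E)) =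
      (real (card (vset n)) - real (card {r, r'})) * ((real n - 3) * top_weight w n 2 4)"
    using V r by (intro sum_constant_off) (auto intro!: sum.neutral dag_sum_eq_0 z)
  then show ?thesis unfolding dag_sum_leaf_count_mult using V r by simp
qed

lemma dag_sum_square_count:
  "dag_sum n w (square_count n) =
    real n * ((real n - 1) * (top_weight w n 1 2 + (real n - 2) * top_weight w n 2 3))"
proof -
  have "dag_sum n w (square_count n) = (\<Sum>r\<in>vset n. dag_sum n w (\<lambda>E. leaf_count n r E * leaf_count n r E))"
    unfolding square_count_def dag_sum_sum power2_eq_square ..
  then show ?thesis by (simp add: dag_sum_leaf_count_square) (simp add: vset_def)
qed

text \<open>Terms with equal roots add up to \<open>square_count\<close>, so a single bound for that
  quantity serves both the variance and the later use of Markov's inequality.\<close>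

lemma dag_sum_pair_count_square:
  "dag_sum n w (\<lambda>E. (pair_count n E)\<^sup>2) = dag_sum n w (square_count n) +
    real n * ((real n - 1) * ((real n - 2) * ((real n - 3) * top_weight w n 2 4)))"
proof -
  have V: "finite (vset n)" "card (vset n) = n" by (auto simp: vset_def)
  let ?J = "\<lambda>r r'. dag_sum n w (\<lambda>E. leaf_count n r E * leaf_count n r' E)"
  have "dag_sum n w (\<lambda>E. (pair_count n E)\<^sup>2) = (\<Sum>r\<in>vset n. \<Sum>r'\<in>vset n. ?J r r')"
    unfolding pair_count_def power2_eq_square sum_product dag_sum_sum ..
  also have "\<dots> = (\<Sum>r\<in>vset n. ?J r r + (real n - 1) * ((real n - 2) * ((real n - 3) * top_weight w n 2 4)))"
  proof (rule sum.cong[OF refl])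
    fix r assume r: "r \<in> vset n"
    then have n: "n > 0" by (auto simp: vset_def)
    have "(\<Sum>r'\<in>vset n. ?J r r') = ?J r r + (\<Sum>r'\<in>vset n - {r}. ?J r r')"
      using V r by (intro sum.remove) auto
    also have "(\<Sum>r'\<in>vset n - {r}. ?J r r') = (\<Sum>r'\<in>vset n - {r}. (real n - 2) * ((real n - 3) * top_weight w n 2 4))"
      by (intro sum.cong refl dag_sum_leaf_count_distinct) (use r in auto)
    also have "\<dots> = (real n - 1) * ((real n - 2) * ((real n - 3) * top_weight w n 2 4))"
      using V r n by (simp add: of_nat_diff)
    finally show "(\<Sum>r'\<in>vset n. ?J r r') =
        ?J r r + (real n - 1) * ((real n - 2) * ((real n - 3) * top_weight w n 2 4))" .
  qed
  also have "\<dots> = dag_sum n w (square_count n) +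
      real n * ((real n - 1) * ((real n - 2) * ((real n - 3) * top_weight w n 2 4)))"
    unfolding square_count_def dag_sum_sum power2_eq_square using V by (simp add: sum.distrib)
  finally show ?thesis .
qed

text \<open>Cauchy-Schwarz against the constant 1 on the roots that have a leaf; all other vertices
  contribute nothing to either sum.\<close>

lemma root_count_bound:
  assumes "E \<in> dags n"
  shows "(pair_count n E)\<^sup>2 \<le> real (card {r. \<exists>v. root_pair E r v}) * square_count n E"
proof -
  let ?R = "{r. \<exists>v. root_pair E r v}"
  have R: "?R \<subseteq> vset n" using assms unfolding root_pair_def dags_def by auto
  have fin: "finite (vset n)" by (simp add: vset_def)
  have 0: "leaf_count n r E = 0" if "r \<notin> ?R" for r using that by (auto simp: leaf_count_def root_pair_ind_def)
  have "pair_count n E = (\<Sum>r\<in>?R. 1 * leaf_count n r E)"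
    unfolding pair_count_def mult_1_left using fin R 0 by (intro sum.mono_neutral_right) auto
  moreover have "square_count n E = (\<Sum>r\<in>?R. (leaf_count n r E)\<^sup>2)"
    unfolding square_count_def using fin R 0 by (intro sum.mono_neutral_right) auto
  ultimately show ?thesis
    using Cauchy_Schwarz_ineq_sum[of "\<lambda>_. 1" "\<lambda>r. leaf_count n r E" ?R] by simp
qed

text \<open>Iterating \<open>mean_sources_Suc\<close> over \<open>k\<close> deleted vertices gives
  \<open>1 + w\<close> the exponent (n-1) + ... + (n-k), which exceeds the
  \<open>k * (n - k)\<close> of \<open>top_weight\<close> by k(k-1)/2. This is the origin of the
  surplus powers 1, 3 and 6; \<open>n = m + 4\<close> leaves room for four deletions.\<close>

lemma dag_sum_moments:
  fixes m :: nat and w :: real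
  assumes w: "w > 0"
  defines "n \<equiv> m + 4"
  defines "\<mu> \<equiv> w * mean_sources w n * mean_sources w (n - 1) / (1 + w)"
  shows "dag_sum n w (pair_count n) = \<mu> * partition_function w n"
    and "dag_sum n w (square_count n) \<le> 2 * \<mu> * partition_function w n"
    and "dag_sum n w (\<lambda>E. (pair_count n E)\<^sup>2) \<le> (2 * \<mu> + \<mu>\<^sup>2) * partition_function w n"
proof -
  define u where "u = 1 + w"
  have u: "u \<ge> 1" "u > 0" using w by (auto simp: u_def)
  define t1 t2 t3 t4 where "t1 = mean_sources w (m + 4)" "t2 = mean_sources w (m + 3)"
    "t3 = mean_sources w (m + 2)" "t4 = mean_sources w (m + 1)"
  define z0 z1 z2 z3 z4 where "z0 = partition_function w (m + 4)" "z1 = partition_function w (m + 3)"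
    "z2 = partition_function w (m + 2)" "z3 = partition_function w (m + 1)" "z4 = partition_function w m"
  note defs = t1_t2_t3_t4_def z0_z1_z2_z3_z4_def
  have e1: "t1 * z0 = (real m + 4) * u ^ (m + 3) * z1"
    using mean_sources_Suc[OF w, of "m + 3"] by (simp add: defs u_def numeral_eq_Suc)
  have e2: "t2 * z1 = (real m + 3) * u ^ (m + 2) * z2"
    using mean_sources_Suc[OF w, of "m + 2"] by (simp add: defs u_def numeral_eq_Suc)
  have e3: "t3 * z2 = (real m + 2) * u ^ (m + 1) * z3"
    using mean_sources_Suc[OF w, of "m + 1"] by (simp add: defs u_def numeral_eq_Suc)
  have e4: "t4 * z3 = (real m + 1) * u ^ m * z4"
    using mean_sources_Suc[OF w, of m] by (simp add: defs u_def)
  have mono: "0 < t4" "t4 \<le> t3" "t3 \<le> t2" "t2 \<le> t1"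
    using mean_sources_Suc_pos[OF w, of m] mean_sources_mono[OF w] by (auto simp: defs)
  have z0: "z0 > 0" using partition_function_pos[OF w] by (simp add: defs)
  have t3: "w * t3 \<le> u" using mean_sources_le[OF w] by (simp add: defs u_def)
  have \<mu>: "\<mu> = w * t1 * t2 / u" by (simp add: \<mu>_def n_def defs u_def numeral_eq_Suc)
  have p2: "t1 * t2 * z0 = (real m + 4) * (real m + 3) * z2 * (u * u ^ (2 * (m + 2)))"
  proof -
    have "t1 * t2 * z0 = (real m + 4) * u ^ (m + 3) * (t2 * z1)"
      using e1 by (simp add: mult_ac)
    also have "\<dots> = (real m + 4) * (real m + 3) * z2 * (u ^ (m + 3) * u ^ (m + 2))"
      unfolding e2 by (simp only: mult_ac)
    also have "u ^ (m + 3) * u ^ (m + 2) = u * u ^ (2 * (m + 2))"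
      unfolding power_add[symmetric] power_Suc[symmetric] by (rule arg_cong[where f = "(^) u"]) simp
    finally show ?thesis .
  qed
  have p3: "t1 * t2 * t3 * z0 = (real m + 4) * (real m + 3) * (real m + 2) * z3 * (u ^ 3 * u ^ (3 * (m + 1)))"
  proof -
    have "t1 * t2 * t3 * z0 = t3 * (t1 * t2 * z0)" by (simp only: mult_ac)
    also have "\<dots> = (real m + 4) * (real m + 3) * (u * u ^ (2 * (m + 2))) * (t3 * z2)"
      unfolding p2 by (simp only: mult_ac)
    also have "\<dots> = (real m + 4) * (real m + 3) * (real m + 2) * z3 * (u * u ^ (2 * (m + 2)) * u ^ (m + 1))"
      unfolding e3 by (simp only: mult_ac)
    also have "u * u ^ (2 * (m + 2)) * u ^ (m + 1) = u ^ 3 * u ^ (3 * (m + 1))"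
      unfolding power_Suc[symmetric] power_add[symmetric] by (rule arg_cong[where f = "(^) u"]) simp
    finally show ?thesis .
  qed
  have p4: "t1 * t2 * t3 * t4 * z0 =
      (real m + 4) * (real m + 3) * (real m + 2) * (real m + 1) * z4 * (u ^ 6 * u ^ (4 * m))"
  proof -
    have "t1 * t2 * t3 * t4 * z0 = t4 * (t1 * t2 * t3 * z0)" by (simp only: mult_ac)
    also have "\<dots> = (real m + 4) * (real m + 3) * (real m + 2) * (u ^ 3 * u ^ (3 * (m + 1))) * (t4 * z3)"
      unfolding p3 by (simp only: mult_ac)
    also have "\<dots> = (real m + 4) * (real m + 3) * (real m + 2) * (real m + 1) * z4 *
        (u ^ 3 * u ^ (3 * (m + 1)) * u ^ m)"
      unfolding e4 by (simp only: mult_ac)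
    also have "u ^ 3 * u ^ (3 * (m + 1)) * u ^ m = u ^ 6 * u ^ (4 * m)"
      unfolding power_add[symmetric] by (rule arg_cong[where f = "(^) u"]) simp
    finally show ?thesis .
  qed
  have cancel: "a / x * (X * (x * U)) = X * (a * U)" if "x \<noteq> 0" for a x X U :: real
    using that by simp
  have tw: "top_weight w n 1 2 = w * u ^ (2 * (m + 2)) * z2"
    "top_weight w n 2 3 = w\<^sup>2 * u ^ (3 * (m + 1)) * z3"
    "top_weight w n 2 4 = w\<^sup>2 * u ^ (4 * m) * z4"
    by (simp_all add: top_weight_def n_def defs u_def)
  have T2: "(real m + 4) * (real m + 3) * top_weight w n 1 2 = \<mu> * z0"
  proof -
    have "\<mu> * z0 = w / u * (t1 * t2 * z0)" by (simp add: \<mu>)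
    also have "\<dots> = (real m + 4) * (real m + 3) * z2 * (w * u ^ (2 * (m + 2)))"
      unfolding p2 by (rule cancel) (use u in simp)
    finally show ?thesis unfolding tw by (simp only: mult_ac)
  qed
  have T3: "(real m + 4) * (real m + 3) * (real m + 2) * top_weight w n 2 3 = \<mu> * (w * t3 / u\<^sup>2) * z0"
  proof -
    have "\<mu> * (w * t3 / u\<^sup>2) * z0 = w\<^sup>2 / u ^ 3 * (t1 * t2 * t3 * z0)"
      by (simp add: \<mu> power2_eq_square power3_eq_cube mult_ac)
    also have "\<dots> = (real m + 4) * (real m + 3) * (real m + 2) * z3 * (w\<^sup>2 * u ^ (3 * (m + 1)))"
      unfolding p3 by (rule cancel) (use u in simp)
    finally show ?thesis unfolding tw by (simp only: mult_ac)
  qed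
  have T4: "(real m + 4) * (real m + 3) * (real m + 2) * (real m + 1) * top_weight w n 2 4 =
      w\<^sup>2 * t1 * t2 * t3 * t4 / u ^ 6 * z0"
  proof -
    have "w\<^sup>2 * t1 * t2 * t3 * t4 / u ^ 6 * z0 = w\<^sup>2 / u ^ 6 * (t1 * t2 * t3 * t4 * z0)"
      by (simp add: mult_ac)
    also have "\<dots> = (real m + 4) * (real m + 3) * (real m + 2) * (real m + 1) * z4 * (w\<^sup>2 * u ^ (4 * m))"
      unfolding p4 by (rule cancel) (use u in simp)
    finally show ?thesis unfolding tw by (simp only: mult_ac)
  qed
  have \<mu>0: "\<mu> \<ge> 0" using w u mono by (simp add: \<mu>)
  have sq: "dag_sum n w (square_count n) = \<mu> * z0 + \<mu> * (w * t3 / u\<^sup>2) * z0"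
    unfolding dag_sum_square_count T2[symmetric] T3[symmetric] by (simp add: n_def algebra_simps)
  show "dag_sum n w (pair_count n) = \<mu> * partition_function w n"
    using T2 unfolding dag_sum_pair_count by (simp add: n_def defs algebra_simps)
  \<comment> \<open>By the upper bound 1/p for the mean source count, two distinct leaves at a
    common root contribute no more than the single pairs.\<close>
  have "w * t3 / u\<^sup>2 \<le> 1"
  proof -
    have "u \<le> u\<^sup>2" using mult_left_mono[OF u(1), of u] u by (simp add: power2_eq_square)
    then show ?thesis using t3 u by simp
  qed
  then have "\<mu> * (w * t3 / u\<^sup>2) \<le> \<mu> * 1" using \<mu>0 by (rule mult_left_mono)
  from mult_right_mono[OF this less_imp_le[OF z0]]
  have "\<mu> * (w * t3 / u\<^sup>2) * z0 \<le> \<mu> * z0" by simp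
  then show sq2: "dag_sum n w (square_count n) \<le> 2 * \<mu> * partition_function w n"
    unfolding sq by (simp add: defs n_def)
  \<comment> \<open>Monotonicity in the number of vertices bounds the contribution of disjoint pairs
    by the squared mean, which leaves a variance of at most \<open>2 * \<mu>\<close>.\<close>
  have "w\<^sup>2 * t1 * t2 * t3 * t4 / u ^ 6 \<le> w\<^sup>2 * t1 * t2 * t1 * t2 / u ^ 2"
  proof (rule frac_le)
    have "t3 * t4 \<le> t1 * t2" using mono by (intro mult_mono) auto
    then show "w\<^sup>2 * t1 * t2 * t3 * t4 \<le> w\<^sup>2 * t1 * t2 * t1 * t2"
      using w mono mult_left_mono[of "t3 * t4" "t1 * t2" "w\<^sup>2 * t1 * t2"] by (simp add: ac_simps)
    show "u\<^sup>2 \<le> u ^ 6" using u by (intro power_increasing) auto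
  qed (use w u mono in auto)
  also have "\<dots> = \<mu>\<^sup>2" by (simp add: \<mu> power2_eq_square)
  finally have "w\<^sup>2 * t1 * t2 * t3 * t4 / u ^ 6 * z0 \<le> \<mu>\<^sup>2 * z0"
    by (rule mult_right_mono[OF _ less_imp_le[OF z0]])
  then have "real n * ((real n - 1) * ((real n - 2) * ((real n - 3) * top_weight w n 2 4))) \<le> \<mu>\<^sup>2 * z0"
    unfolding T4[symmetric] by (simp add: n_def algebra_simps)
  then show "dag_sum n w (\<lambda>E. (pair_count n E)\<^sup>2) \<le> (2 * \<mu> + \<mu>\<^sup>2) * partition_function w n"
    using sq2 unfolding dag_sum_pair_count_square by (simp add: distrib_right defs n_def)
qed

subsection \<open>Concentration\<close>

text \<open>The indicator of the good event is bounded below pointwise by \<open>1 - 4 /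
  \<mu>\<^sup>2 * (X E - \<mu>)\<^sup>2 - Q E / (2 * \<mu> * K)\<close>, which merges Chebyshev and
  Markov into one estimate. The losses are \<open>4 / \<mu>\<^sup>2\<close> times the variance bound
  \<open>2 * \<mu>\<close>, and \<open>1 / K\<close>.\<close>

lemma weighted_chebyshev_markov:
  fixes \<omega> X Q :: "'a \<Rightarrow> real"
  assumes fin: "finite D" and \<omega>: "\<And>E. E \<in> D \<Longrightarrow> \<omega> E \<ge> 0" and Q: "\<And>E. E \<in> D \<Longrightarrow> Q E \<ge> 0"
    and \<mu>: "\<mu> > 0" and K: "K > 0"
    and Z: "(\<Sum>E\<in>D. \<omega> E * 1) = Z"
    and mX: "(\<Sum>E\<in>D. \<omega> E * X E) = \<mu> * Z"
    and mQ: "(\<Sum>E\<in>D. \<omega> E * Q E) \<le> 2 * \<mu> * Z"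
    and mX2: "(\<Sum>E\<in>D. \<omega> E * (X E)\<^sup>2) \<le> (2 * \<mu> + \<mu>\<^sup>2) * Z"
  shows "(1 - 8 / \<mu> - 1 / K) * Z \<le> (\<Sum>E\<in>{E \<in> D. \<mu> / 2 \<le> X E \<and> Q E \<le> 2 * \<mu> * K}. \<omega> E)"
proof -
  let ?good = "\<lambda>E. \<mu> / 2 \<le> X E \<and> Q E \<le> 2 * \<mu> * K"
  let ?b = "\<lambda>E. 1 - 4 / \<mu>\<^sup>2 * (X E - \<mu>)\<^sup>2 - 1 / (2 * \<mu> * K) * Q E"
  have pt: "\<omega> E * ?b E \<le> (if ?good E then \<omega> E else 0)" if E: "E \<in> D" for E
  proof -
    have sq: "0 \<le> 4 / \<mu>\<^sup>2 * (X E - \<mu>)\<^sup>2" and q: "0 \<le> 1 / (2 * \<mu> * K) * Q E"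
      using Q[OF E] \<mu> K by auto
    show ?thesis
    proof (cases "?good E")
      case True
      have "?b E \<le> 1" using sq q by linarith
      from mult_left_mono[OF this \<omega>[OF E]] have "\<omega> E * ?b E \<le> \<omega> E * 1" .
      then show ?thesis using True by simp
    next
      case False
      have "?b E \<le> 0"
      proof (cases "\<mu> / 2 \<le> X E")
        case True
        then have "2 * \<mu> * K < Q E" using False by auto
        then have "1 / (2 * \<mu> * K) * Q E \<ge> 1" using \<mu> K by (simp add: field_simps)
        then show ?thesis using sq by linarith
      next
        case False
        then have "(\<mu> / 2)\<^sup>2 \<le> (\<mu> - X E)\<^sup>2" using \<mu> by (intro power_mono) auto
        then have "4 / \<mu>\<^sup>2 * (\<mu> / 2)\<^sup>2 \<le> 4 / \<mu>\<^sup>2 * (X E - \<mu>)\<^sup>2"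
          by (intro mult_left_mono) (auto simp: power2_commute)
        moreover have "4 / \<mu>\<^sup>2 * (\<mu> / 2)\<^sup>2 = 1" using \<mu> by (simp add: power_divide)
        ultimately show ?thesis using q by linarith
      qed
      then have "\<omega> E * ?b E \<le> 0" using \<omega>[OF E] by (rule mult_nonneg_nonpos[rotated])
      then show ?thesis using False by auto
    qed
  qed
  have "(\<Sum>E\<in>D. \<omega> E * ?b E) = (\<Sum>E\<in>D. \<omega> E * 1) - 4 / \<mu>\<^sup>2 * ((\<Sum>E\<in>D. \<omega> E * (X E)\<^sup>2)
      - 2 * \<mu> * (\<Sum>E\<in>D. \<omega> E * X E) + \<mu>\<^sup>2 * (\<Sum>E\<in>D. \<omega> E * 1)) - 1 / (2 * \<mu> * K) * (\<Sum>E\<in>D. \<omega> E * Q E)"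
    unfolding sum_distrib_left sum.distrib[symmetric] sum_subtractf[symmetric]
    by (intro sum.cong refl) (simp add: power2_eq_square algebra_simps)
  also have "\<dots> \<ge> Z - 4 / \<mu>\<^sup>2 * ((2 * \<mu> + \<mu>\<^sup>2) * Z - 2 * \<mu> * (\<mu> * Z) + \<mu>\<^sup>2 * Z) - 1 / (2 * \<mu> * K) * (2 * \<mu> * Z)"
    unfolding Z mX using mX2 mQ \<mu> K by (intro diff_mono mult_left_mono add_mono) auto
  also have "Z - 4 / \<mu>\<^sup>2 * ((2 * \<mu> + \<mu>\<^sup>2) * Z - 2 * \<mu> * (\<mu> * Z) + \<mu>\<^sup>2 * Z) - 1 / (2 * \<mu> * K) * (2 * \<mu> * Z) =
      (1 - 8 / \<mu> - 1 / K) * Z"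
    using \<mu> K by (simp add: power2_eq_square field_simps)
  finally have "(1 - 8 / \<mu> - 1 / K) * Z \<le> (\<Sum>E\<in>D. \<omega> E * ?b E)" .
  also have "\<dots> \<le> (\<Sum>E\<in>D. if ?good E then \<omega> E else 0)"
    by (intro sum_mono pt)
  also have "\<dots> = (\<Sum>E\<in>{E \<in> D. ?good E}. \<omega> E)"
    by (rule sum.inter_filter[OF fin, symmetric])
  finally show ?thesis .
qed

text \<open>The bound of \<open>mean_sources_ge\<close> decays for large sizes, so it is applied at
  a size near 1/(2p), where Bernoulli's inequality keeps (1-p)^k at least 1/2, and is then carried
  to \<open>m\<close> by monotonicity.\<close>

lemma mean_sources_ge_inverse:
  fixes p :: real
  assumes p: "0 < p" "p < 1" and m: "1 / (2 * p) + 1 \<le> real m"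
  shows "1 / (4 * p) \<le> mean_sources (p / (1 - p)) m"
proof -
  let ?w = "p / (1 - p)"
  have w: "?w > 0" "1 + ?w = 1 / (1 - p)" using p by (auto simp: field_simps)
  define k where "k = nat \<lfloor>1 / (2 * p)\<rfloor>"
  have "1 / (2 * p) > 0" using p by simp
  then have k: "real k \<le> 1 / (2 * p)" "1 / (2 * p) \<le> real (Suc k)"
    unfolding k_def by linarith+
  have "Suc k \<le> m" using k(1) m by linarith
  have "real k * p \<le> 1 / (2 * p) * p" using k p by (intro mult_right_mono) auto
  then have "1 / 2 \<le> 1 + real k * (- p)" using p by simp
  also have "\<dots> \<le> (1 + - p) ^ k" using p by (intro Bernoulli_inequality) auto
  finally have "1 / 2 \<le> (1 - p) ^ k" by simp
  then have "1 / (2 * p) * (1 / 2) \<le> real (Suc k) * (1 - p) ^ k"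
    using k p by (intro mult_mono) auto
  also have "\<dots> = real (Suc k) / (1 + ?w) ^ k"
    using p unfolding w(2) by (simp add: power_one_over)
  also have "\<dots> \<le> mean_sources ?w (Suc k)" by (rule mean_sources_ge[OF w(1)])
  also have "\<dots> \<le> mean_sources ?w m" by (rule mean_sources_mono[OF w(1) \<open>Suc k \<le> m\<close>])
  finally show ?thesis by simp
qed

text \<open>Both constants 128 are 16 * 8: with \<open>\<mu> \<ge> 1 / (16 * p)\<close>, the loss
  \<open>8 / \<mu>\<close> is at most \<open>128 * p\<close>, and on the good event the root count
  is at least (\<mu>/2)^2 / (2 \<mu> K) = \<mu> / (8 K).\<close>

lemma D_prob_card_MEC_ge:
  fixes p K :: real
  assumes p: "0 < p" "p < 1" "6 / p \<le> real n" and K: "K > 0"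
  shows "D_prob n p {G. real (card (MEC n G)) \<ge> 2 powr (1 / (128 * p * K))} \<ge> 1 - 128 * p - 1 / K"
proof -
  define w where "w = p / (1 - p)"
  have w: "w > 0" using p by (simp add: w_def)
  have wp: "w / (1 + w) = p" using p by (simp add: w_def field_simps)
  have n6: "6 < real n"
  proof -
    have "6 < 6 / p" using p by (simp add: field_simps)
    then show ?thesis using p by linarith
  qed
  then have "n = (n - 4) + 4" by linarith
  then obtain m where m: "n = m + 4" by blast
  define \<mu> where "\<mu> = w * mean_sources w n * mean_sources w (n - 1) / (1 + w)"
  have \<mu>_eq: "\<mu> = p * (mean_sources w n * mean_sources w (n - 1))"
    unfolding \<mu>_def wp[symmetric] by simp
  have big: "1 / (2 * p) + 1 \<le> real (n - 1)" "1 / (2 * p) + 1 \<le> real n"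
  proof -
    \<comment> \<open>The constant 6 leaves room for the vertex lost in
      \<open>n - 1\<close>.\<close>
    have "1 / (2 * p) + 2 \<le> 6 / p" using p by (simp add: field_simps)
    then show "1 / (2 * p) + 1 \<le> real (n - 1)" "1 / (2 * p) + 1 \<le> real n"
      using p(3) m by (auto simp: of_nat_diff)
  qed
  have "1 / (4 * p) * (1 / (4 * p)) \<le> mean_sources w n * mean_sources w (n - 1)"
  proof (rule mult_mono)
    show t: "1 / (4 * p) \<le> mean_sources w n" "1 / (4 * p) \<le> mean_sources w (n - 1)"
      unfolding w_def using mean_sources_ge_inverse[OF p(1,2)] big by auto
    have "0 < 1 / (4 * p)" using p by simp
    then show "0 \<le> mean_sources w n" "0 \<le> 1 / (4 * p)" using t by linarith+
  qed
  from mult_left_mono[OF this less_imp_le[OF p(1)]]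
  have \<mu>_ge: "1 / (16 * p) \<le> \<mu>" using p unfolding \<mu>_eq by (simp add: field_simps)
  have \<mu>: "\<mu> > 0" using \<mu>_ge p by (smt (verit) divide_pos_pos)
  have "8 / \<mu> \<le> 8 / (1 / (16 * p))" using \<mu>_ge \<mu> p by (intro divide_left_mono) auto
  then have \<mu>8: "8 / \<mu> \<le> 128 * p" by simp
  define Z where "Z = partition_function w n"
  have Z: "Z > 0" unfolding Z_def by (rule partition_function_pos[OF w])
  have Zsum: "(\<Sum>E\<in>dags n. w ^ card E * 1) = Z"
    using dag_sum_one[of n w] by (simp add: dag_sum_def Z_def)
  let ?good = "{E \<in> dags n. \<mu> / 2 \<le> pair_count n E \<and> square_count n E \<le> 2 * \<mu> * K}"
  let ?S = "{G. real (card (MEC n G)) \<ge> 2 powr (1 / (128 * p * K))}"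
  have "(1 - 8 / \<mu> - 1 / K) * Z \<le> (\<Sum>E\<in>?good. w ^ card E)"
  proof (rule weighted_chebyshev_markov[OF finite_dags _ _ \<mu> K Zsum])
    show "w ^ card E \<ge> 0" for E :: "(nat \<times> nat) set" using w by simp
    show "square_count n E \<ge> 0" for E by (simp add: square_count_def sum_nonneg)
  qed (use dag_sum_moments[OF w, of m] in \<open>simp_all add: dag_sum_def \<mu>_def Z_def m\<close>)
  also have "\<dots> \<le> (\<Sum>E\<in>dags n \<inter> ?S. w ^ card E)"
  proof (rule sum_mono2)
    show "?good \<subseteq> dags n \<inter> ?S"
    proof
      fix E assume "E \<in> ?good"
      then have E: "E \<in> dags n" and X: "\<mu> / 2 \<le> pair_count n E"
        and Q: "square_count n E \<le> 2 * \<mu> * K" by auto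
      let ?R = "card {r. \<exists>v. root_pair E r v}"
      have "(\<mu> / 2)\<^sup>2 \<le> (pair_count n E)\<^sup>2" using X \<mu> by (intro power_mono) auto
      also have "\<dots> \<le> real ?R * square_count n E" by (rule root_count_bound[OF E])
      also have "\<dots> \<le> real ?R * (2 * \<mu> * K)" using Q by (intro mult_left_mono) auto
      finally have "\<mu> / (8 * K) \<le> real ?R"
        using \<mu> K by (simp add: power2_eq_square field_simps)
      moreover have "1 / (16 * p) / (8 * K) \<le> \<mu> / (8 * K)"
        using \<mu>_ge K by (intro divide_right_mono) auto
      ultimately have "1 / (128 * p * K) \<le> real ?R" by simp
      then have "2 powr (1 / (128 * p * K)) \<le> 2 powr real ?R" by simp
      also have "\<dots> = real (2 ^ ?R)" by (simp add: powr_realpow)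
      also have "\<dots> \<le> real (card (MEC n E))"
        using card_MEC_ge[OF E] by (rule of_nat_mono)
      finally show "E \<in> dags n \<inter> ?S" using E by simp
    qed
  qed (use w finite_dags in auto)
  finally have "1 - 8 / \<mu> - 1 / K \<le> (\<Sum>E\<in>dags n \<inter> ?S. w ^ card E) / Z"
    using Z by (simp add: pos_le_divide_eq)
  also have "\<dots> = D_prob n p ?S"
    unfolding D_prob_def dag_weight_def w_def[symmetric] using Zsum by simp
  finally show ?thesis using \<mu>8 by linarith
qed

section \<open>From the concentration bound to the limit and the expectation\<close>

lemma sum_dag_weight_pos:
  assumes "0 < p" "p < 1"
  shows "(\<Sum>G\<in>dags n. dag_weight p G) > 0"
proof -
  have "(\<Sum>G\<in>dags n. dag_weight p G) = partition_function (p / (1 - p)) n"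
    using dag_sum_one[of n "p / (1 - p)"] by (simp add: dag_sum_def dag_weight_def)
  then show ?thesis using partition_function_pos assms by simp
qed

lemma D_prob_mono:
  assumes p: "0 < p" "p < 1" and "S \<subseteq> T"
  shows "D_prob n p S \<le> D_prob n p T"
  unfolding D_prob_def
proof (rule divide_right_mono)
  show "(\<Sum>G\<in>dags n \<inter> S. dag_weight p G) \<le> (\<Sum>G\<in>dags n \<inter> T. dag_weight p G)"
    using assms finite_dags by (intro sum_mono2) (auto simp: dag_weight_def)
qed (use sum_dag_weight_pos[OF p] in \<open>simp add: less_imp_le\<close>)

lemma D_prob_le_1:
  assumes p: "0 < p" "p < 1"
  shows "D_prob n p S \<le> 1"
proof -
  have "D_prob n p UNIV = 1" using sum_dag_weight_pos[OF p, of n] by (simp add: D_prob_def)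
  then show ?thesis using D_prob_mono[OF p, of S UNIV n] by simp
qed

lemma D_expect_markov:
  assumes p: "0 < p" "p < 1" and X: "\<And>G. X G \<ge> 0" and a: "a \<ge> 0"
  shows "a * D_prob n p {G. X G \<ge> a} \<le> D_expect n p X"
proof -
  have "a * (\<Sum>G\<in>dags n \<inter> {G. X G \<ge> a}. dag_weight p G) \<le> (\<Sum>G\<in>dags n \<inter> {G. X G \<ge> a}. dag_weight p G * X G)"
    unfolding sum_distrib_left using p
    by (intro sum_mono) (auto simp: dag_weight_def mult.commute[of a] intro!: mult_left_mono)
  also have "\<dots> \<le> (\<Sum>G\<in>dags n. dag_weight p G * X G)"
    using p X finite_dags by (intro sum_mono2) (auto simp: dag_weight_def)
  finally show ?thesis
    unfolding D_prob_def D_expect_def using sum_dag_weight_pos[OF p, of n]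
    by (simp add: divide_right_mono)
qed

theorem theorem1:
  "\<exists>c::real. c > 0 \<and>
    (\<forall>p :: nat \<Rightarrow> real.
       (\<forall>\<^sub>F n in sequentially. 6 / real n \<le> p n \<and> p n < 1) \<and>
       ((\<lambda>n. p n * ln (real n)) \<longlongrightarrow> 0) sequentially \<longrightarrow>
       ((\<lambda>n. D_prob n (p n)
           {G. real (card (MEC n G)) \<ge> 2 powr (c * (1 / p n) / (ln (1 / p n))\<^sup>2)})
          \<longlongrightarrow> 1) sequentially \<and>
       (\<forall>\<^sub>F n in sequentially.
          D_expect n (p n) (\<lambda>G. real (card (MEC n G)))
            \<ge> 2 powr (c * (1 / p n) / (ln (1 / p n))\<^sup>2)))"
proof (intro exI[of _ "1 / 256"] conjI allI impI; (elim conjE)?)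
  \<comment> \<open>The concentration bound holds with 1/128. Halving the exponent absorbs the
    factor 1/2 lost in passing from probability to expectation.\<close>
  show "(1 / 256 :: real) > 0" by simp
  fix p :: "nat \<Rightarrow> real"
  assume bounds: "\<forall>\<^sub>F n in sequentially. 6 / real n \<le> p n \<and> p n < 1"
    and lim: "((\<lambda>n. p n * ln (real n)) \<longlongrightarrow> 0) sequentially"
  let ?y = "\<lambda>p::real. (1 / p) / (ln (1 / p))\<^sup>2"
  let ?S = "\<lambda>c n. {G. real (card (MEC n G)) \<ge> 2 powr (c * (1 / p n) / (ln (1 / p n))\<^sup>2)}"
  have ev: "\<forall>\<^sub>F n in sequentially. 0 < p n \<and> p n < 1 \<and> 6 / p n \<le> real n \<and> 1 \<le> ln (real n)"
    using bounds eventually_ge_at_top[of 3]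
  proof eventually_elim
    case (elim n)
    then have "0 < 6 / real n" by simp
    then have p: "0 < p n" using elim by linarith
    have "ln (exp 1) \<le> ln (real n)"
      using elim exp_le by (subst ln_le_cancel_iff) auto
    then show ?case using elim p by (auto simp: field_simps)
  qed
  \<comment> \<open>Since eventually \<open>ln (real n) \<ge> 1\<close>, the sequence is squeezed by
    \<open>p n * ln (real n)\<close>.\<close>
  have "p \<longlonglongrightarrow> 0"
  proof (rule Lim_null_comparison[OF _ lim])
    show "\<forall>\<^sub>F n in sequentially. norm (p n) \<le> p n * ln (real n)"
      using ev
    proof eventually_elim
      case (elim n)
      then show ?case using mult_left_mono[of 1 "ln (real n)" "p n"] by auto
    qed
  qed
  then have p0: "filterlim p (at_right 0) sequentially"
    using ev by (auto simp: filterlim_at elim: eventually_mono)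
  have main: "\<forall>\<^sub>F n in sequentially.
      D_prob n (p n) (?S (1 / 128) n) \<ge> 1 - 128 * p n - 1 / (ln (1 / p n))\<^sup>2"
    using ev
  proof eventually_elim
    case (elim n)
    then have "(ln (1 / p n))\<^sup>2 > 0" by (auto simp: ln_div)
    from D_prob_card_MEC_ge[of "p n" n, OF _ _ _ this] elim show ?case by simp
  qed
  have "((\<lambda>x::real. 1 - 128 * x - 1 / (ln (1 / x))\<^sup>2) \<longlongrightarrow> 1) (at_right 0)"
    by real_asymp
  from filterlim_compose[OF this p0]
  have low: "(\<lambda>n. 1 - 128 * p n - 1 / (ln (1 / p n))\<^sup>2) \<longlonglongrightarrow> 1" .
  have sub: "?S (1 / 128) n \<subseteq> ?S (1 / 256) n" if "0 < p n" for n
  proof -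
    have "1 / 256 * (1 / p n) / (ln (1 / p n))\<^sup>2 \<le> 1 / 128 * (1 / p n) / (ln (1 / p n))\<^sup>2"
      using that by (intro divide_right_mono mult_right_mono) auto
    then have "2 powr (1 / 256 * (1 / p n) / (ln (1 / p n))\<^sup>2) \<le> 2 powr (1 / 128 * (1 / p n) / (ln (1 / p n))\<^sup>2)"
      by (intro powr_mono) auto
    then show ?thesis by (intro Collect_mono impI) (rule order_trans)
  qed
  show "((\<lambda>n. D_prob n (p n) (?S (1 / 256) n)) \<longlongrightarrow> 1) sequentially"
  proof (rule tendsto_sandwich[OF _ _ low tendsto_const])
    show "\<forall>\<^sub>F n in sequentially. 1 - 128 * p n - 1 / (ln (1 / p n))\<^sup>2 \<le> D_prob n (p n) (?S (1 / 256) n)"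
      using main ev
    proof eventually_elim
      case (elim n)
      then show ?case using D_prob_mono[of "p n" _ _ n, OF _ _ sub[of n]] by (meson order_trans)
    qed
    show "\<forall>\<^sub>F n in sequentially. D_prob n (p n) (?S (1 / 256) n) \<le> 1"
      using ev by eventually_elim (auto intro: D_prob_le_1)
  qed
  have "filterlim ?y at_top (at_right 0)" by real_asymp
  from filterlim_compose[OF this p0]
  have y: "\<forall>\<^sub>F n in sequentially. 256 \<le> ?y (p n)"
    by (auto simp: filterlim_at_top)
  have half: "\<forall>\<^sub>F n in sequentially. 1 / 2 < 1 - 128 * p n - 1 / (ln (1 / p n))\<^sup>2"
    by (rule order_tendstoD(1)[OF low]) simp
  show "\<forall>\<^sub>F n in sequentially. D_expect n (p n) (\<lambda>G. real (card (MEC n G)))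
      \<ge> 2 powr (1 / 256 * (1 / p n) / (ln (1 / p n))\<^sup>2)"
    using ev main y half
  proof eventually_elim
    case (elim n)
    let ?a = "2 powr (1 / 128 * (1 / p n) / (ln (1 / p n))\<^sup>2)"
    \<comment> \<open>From \<open>256 \<le> ?y (p n)\<close> the exponents with 1/128 and 1/256
      differ by at least 1.\<close>
    have "2 powr (1 / 256 * (1 / p n) / (ln (1 / p n))\<^sup>2) \<le> 2 powr (1 / 128 * (1 / p n) / (ln (1 / p n))\<^sup>2 - 1)"
      using elim(3) by (intro powr_mono) auto
    also have "\<dots> = ?a * (1 / 2)" by (simp add: powr_diff)
    also have "\<dots> \<le> ?a * D_prob n (p n) (?S (1 / 128) n)"
      using elim by (intro mult_left_mono) auto
    also have "\<dots> \<le> D_expect n (p n) (\<lambda>G. real (card (MEC n G)))"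
      using elim by (intro D_expect_markov) auto
    finally show ?case .
  qed
qed

end
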